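(* Let $n\ge 1$ and let $r,s\in\mathbb C$ be generic. In the quantum coordinate ring $\mathcal A_{r,s}(2n)$ with generator matrix $A=(a_{ij})_{1\le i,j\le 2n}$ one has $$\mathrm{Pf}_r\big(A^T\,\mathbb J_{s^{-1}}\,A\big)=\mathrm{rdet}_r(A),$$ where $A^T\mathbb J_{s^{-1}}A=(b_{ij})_{1\le i,j\le 2n}$ with $$b_{ij}=\sum_{m=1}^n\big(a_{2m-1,i}\,a_{2m,j}-s^{-1}a_{2m,i}\,a_{2m-1,j}\big).$$
   Context: Generic means: $r,s$ are nonzero and none of $r$, $s$, $r/s$ is a root of unity. For $N\ge1$, $\mathcal A_{r,s}(N)$ is the unital associative $\mathbb C$-algebra generated by $a_{ij}$, $1\le i,j\le N$, subject to the relations, for all $i<j$ and $k<l$ (the first for every row $i$, the second for every column $k$): $a_{ik}a_{il}=r\,a_{il}a_{ik}$; $a_{ik}a_{jk}=s^{-1}a_{jk}a_{ik}$; $r\,a_{il}a_{jk}=s^{-1}a_{jk}a_{il}$; $a_{ik}a_{jl}-a_{jl}a_{ik}=(r-s)a_{il}a_{jk}$. The quantum row-determinant is $\mathrm{rdet}_r(A)=\sum_{\sigma\in S_N}(-r)^{l(\sigma)}a_{1,\sigma(1)}\cdots a_{N,\sigma(N)}$, where $l(\sigma)$ is the number of inversions of $\sigma$. $\mathbb J_v$ is the $2n\times 2n$ block-diagonal matrix $\mathrm{diag}(J_v,\dots,J_v)$ with $n$ blocks $J_v=\begin{pmatrix}0&1\\-v&0\end{pmatrix}$. For a $2n\times 2n$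 matrix $B=(b_{ij})$ with entries in an associative $\mathbb C$-algebra, the quantum Pfaffian is $$\mathrm{Pf}_v(B)=\frac1{[n]_{v^4}!}\sum_{\sigma\in\Pi'}(-v)^{l(\sigma)}b_{\sigma(1)\sigma(2)}b_{\sigma(3)\sigma(4)}\cdots b_{\sigma(2n-1)\sigma(2n)},$$ where $\Pi'$ is the set of $\sigma\in S_{2n}$ with $\sigma(2i-1)<\sigma(2i)$ for $i=1,\dots,n$, and $[n]_u!=[n]_u\cdots[1]_u$, $[k]_u=1+u+\cdots+u^{k-1}$. *)

theory Defs
  imports
    Complex_Main
    "HOL-Library.Poly_Mapping"
    "HOL-Combinatorics.Permutations"
    "HOL-Algebra.QuotRing"
    "HOL-Algebra.Module"
begin

section \<open>Associative algebras over the complex numbers\<close>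

definition complex_field :: "complex ring" where
  "complex_field = \<lparr>carrier = UNIV, mult = (*), one = 1, zero = 0, add = (+)\<rparr>"

lemma complex_field_cring: "cring complex_field"
proof (rule cringI)
  show "abelian_group complex_field"
    by (rule abelian_groupI)
      (simp_all add: complex_field_def algebra_simps, metis add.right_inverse)
  show "comm_monoid complex_field"
    by unfold_locales (auto simp: complex_field_def)
qed (simp add: complex_field_def algebra_simps)

text \<open>The library locale \<open>algebra\<close> demands a commutative product, so it does not
  apply to quantum coordinate rings.\<close>

locale complex_assoc_algebra = module complex_field M + ring M for M (structure) +
  assumes smult_mult_left:
      "\<lbrakk>x \<in> carrier M; y \<in> carrier M\<rbrakk> \<Longrightarrow> (c \<odot> x) \<otimes> y = c \<odot> (x \<otimes> y)"
    and smult_mult_right: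
      "\<lbrakk>x \<in> carrier M; y \<in> carrier M\<rbrakk> \<Longrightarrow> x \<otimes> (c \<odot> y) = c \<odot> (x \<otimes> y)"


section \<open>Free associative algebras\<close>

text \<open>Words, written additively so that the convolution product of finitely supported
  functions from \<open>Poly_Mapping\<close> is the product of noncommutative polynomials.\<close>

datatype 'a word = Word (letters: "'a list")

instantiation word :: (type) monoid_add
begin

definition "0 = Word []"

definition "u + v = Word (letters u @ letters v)"

instance
  by standard (simp_all add: zero_word_def plus_word_def)

end

type_synonym 'a ncpoly = "'a word \<Rightarrow>\<^sub>0 complex"

abbreviation Const :: "complex \<Rightarrow> 'a ncpoly" where
  "Const c \<equiv> Poly_Mapping.single 0 c"

abbreviation Var :: "'a \<Rightarrow> 'a ncpoly" where
  "Var x \<equiv> Poly_Mapping.single (Word [x]) 1"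

definition free_algebra :: "'a set \<Rightarrow> (complex, 'a ncpoly) module" where
  "free_algebra X =
    \<lparr>carrier = {p. \<forall>w \<in> Poly_Mapping.keys p. set (letters w) \<subseteq> X},
     mult = (*), one = 1, zero = 0, add = (+), smult = (\<lambda>c p. Const c * p)\<rparr>"


lemma Const_commute: "Const c * p = p * Const c"
proof (induction p rule: update_induct)
  case const
  show ?case by simp
next
  case (update p k v)
  then have "Poly_Mapping.update k v p = p + Poly_Mapping.single k v"
    by (intro poly_mapping_eqI)
      (auto simp: lookup_update lookup_add lookup_single in_keys_iff when_def)
  with update.IH show ?case
    by (simp add: distrib_left distrib_right mult_single mult.commute)
qed

lemma Const_in_carrier: "Const c \<in> carrier (free_algebra X)"
  by (auto simp: free_algebra_def zero_word_def split: if_splits)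

lemma mult_in_carrier:
  assumes "p \<in> carrier (free_algebra X)" "q \<in> carrier (free_algebra X)"
  shows "p * q \<in> carrier (free_algebra X)"
  using assms keys_mult[of p q] by (fastforce simp: free_algebra_def plus_word_def)

lemma free_algebra_sel [simp]:
  "p \<otimes>\<^bsub>free_algebra X\<^esub> q = p * q" "\<one>\<^bsub>free_algebra X\<^esub> = 1" "\<zero>\<^bsub>free_algebra X\<^esub> = 0"
  "p \<oplus>\<^bsub>free_algebra X\<^esub> q = p + q" "c \<odot>\<^bsub>free_algebra X\<^esub> p = Const c * p"
  by (simp_all add: free_algebra_def)

lemma free_algebra_ring: "ring (free_algebra X)"
proof (rule ringI)
  show "abelian_group (free_algebra X)"
  proof (rule abelian_groupI)
    fix p q assume "p \<in> carrier (free_algebra X)" "q \<in> carrier (free_algebra X)"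
    then show "p \<oplus>\<^bsub>free_algebra X\<^esub> q \<in> carrier (free_algebra X)"
      using Poly_Mapping.keys_add[of p q] by (auto simp: free_algebra_def)
  next
    fix p assume "p \<in> carrier (free_algebra X)"
    then have "- p \<in> carrier (free_algebra X)" "- p \<oplus>\<^bsub>free_algebra X\<^esub> p = \<zero>\<^bsub>free_algebra X\<^esub>"
      by (simp_all, simp add: free_algebra_def)
    then show "\<exists>q\<in>carrier (free_algebra X). q \<oplus>\<^bsub>free_algebra X\<^esub> p = \<zero>\<^bsub>free_algebra X\<^esub>"
      by blast
  qed (simp_all add: add.assoc add.commute, simp add: free_algebra_def)
  show "Group.monoid (free_algebra X)"
    using Const_in_carrier[of 1 X]
    by (intro monoidI) (simp_all add: mult_in_carrier mult.assoc)
qed (simp_all add: algebra_simps)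

lemma free_algebra_assoc_algebra: "complex_assoc_algebra (free_algebra X)"
proof -
  interpret R: ring "free_algebra X" by (rule free_algebra_ring)
  have sc: "Const c * p \<in> carrier (free_algebra X)" if "p \<in> carrier (free_algebra X)" for c p
    using that by (intro mult_in_carrier Const_in_carrier)
  have "module complex_field (free_algebra X)"
    by (rule moduleI[OF complex_field_cring R.abelian_group_axioms])
      (simp_all add: sc complex_field_def distrib_left distrib_right single_add
        mult.assoc[symmetric] mult_single)
  moreover have "p * (Const c * q) = Const c * (p * q)" for p q :: "'a ncpoly" and c
    using Const_commute[of c p] by (metis mult.assoc)
  ultimately show ?thesis
    by (intro complex_assoc_algebra.intro complex_assoc_algebra_axioms.intro free_algebra_ring)
      (simp_all add: mult.assoc)
qed


section \<open>Algebras given by generators and relations\<close>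

definition quot_algebra :: "(complex, 'b) module \<Rightarrow> 'b set \<Rightarrow> (complex, 'b set) module" where
  "quot_algebra F I = ring.extend (F Quot I)
     (module.fields (\<lambda>c P. \<Union>p\<in>P. I +>\<^bsub>F\<^esub> (c \<odot>\<^bsub>F\<^esub> p)))"

lemma quot_algebra_sel:
  "carrier (quot_algebra F I) = carrier (F Quot I)"
  "x \<otimes>\<^bsub>quot_algebra F I\<^esub> y = x \<otimes>\<^bsub>F Quot I\<^esub> y"
  "\<one>\<^bsub>quot_algebra F I\<^esub> = \<one>\<^bsub>F Quot I\<^esub>"
  "\<zero>\<^bsub>quot_algebra F I\<^esub> = \<zero>\<^bsub>F Quot I\<^esub>"
  "x \<oplus>\<^bsub>quot_algebra F I\<^esub> y = x \<oplus>\<^bsub>F Quot I\<^esub> y"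
  "c \<odot>\<^bsub>quot_algebra F I\<^esub> x = (\<Union>p\<in>x. I +>\<^bsub>F\<^esub> (c \<odot>\<^bsub>F\<^esub> p))"
  by (simp_all add: quot_algebra_def ring.defs module.defs)

context
  fixes F :: "(complex, 'b) module" and I
  assumes F: "complex_assoc_algebra F" and I: "ideal I F"
begin

interpretation F: complex_assoc_algebra F by (rule F)
interpretation I: ideal I F by (rule I)

lemma quot_algebra_class_ops:
  assumes "x \<in> carrier F" "y \<in> carrier F"
  shows "(I +>\<^bsub>F\<^esub> x) \<otimes>\<^bsub>quot_algebra F I\<^esub> (I +>\<^bsub>F\<^esub> y) = I +>\<^bsub>F\<^esub> (x \<otimes>\<^bsub>F\<^esub> y)"
    and "(I +>\<^bsub>F\<^esub> x) \<oplus>\<^bsub>quot_algebra F I\<^esub> (I +>\<^bsub>F\<^esub> y) = I +>\<^bsub>F\<^esub> (x \<oplus>\<^bsub>F\<^esub> y)"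
    and "c \<odot>\<^bsub>quot_algebra F I\<^esub> (I +>\<^bsub>F\<^esub> x) = I +>\<^bsub>F\<^esub> (c \<odot>\<^bsub>F\<^esub> x)"
proof -
  show "(I +>\<^bsub>F\<^esub> x) \<otimes>\<^bsub>quot_algebra F I\<^esub> (I +>\<^bsub>F\<^esub> y) = I +>\<^bsub>F\<^esub> (x \<otimes>\<^bsub>F\<^esub> y)"
    using assms by (simp add: quot_algebra_sel FactRing_def I.rcoset_mult_add)
  show "(I +>\<^bsub>F\<^esub> x) \<oplus>\<^bsub>quot_algebra F I\<^esub> (I +>\<^bsub>F\<^esub> y) = I +>\<^bsub>F\<^esub> (x \<oplus>\<^bsub>F\<^esub> y)"
    using assms by (simp add: quot_algebra_sel FactRing_def I.a_rcos_sum)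
  have sc: "c \<odot>\<^bsub>F\<^esub> z \<in> carrier F" if "z \<in> carrier F" for z
    using that by (simp add: F.smult_closed complex_field_def)
  have "I +>\<^bsub>F\<^esub> (c \<odot>\<^bsub>F\<^esub> z) = I +>\<^bsub>F\<^esub> (c \<odot>\<^bsub>F\<^esub> x)" if "z \<in> I +>\<^bsub>F\<^esub> x" for z
  proof -
    from that obtain h where h: "h \<in> I" "z = h \<oplus>\<^bsub>F\<^esub> x"
      by (auto simp: a_r_coset_def')
    have hc: "h \<in> carrier F" using h(1) by (rule I.a_Hcarr)
    have "c \<odot>\<^bsub>F\<^esub> h = (c \<odot>\<^bsub>F\<^esub> \<one>\<^bsub>F\<^esub>) \<otimes>\<^bsub>F\<^esub> h"
      using hc by (simp add: F.smult_mult_left)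
    also have "\<dots> \<in> I" using h(1) sc by (intro I.I_l_closed) auto
    finally have "c \<odot>\<^bsub>F\<^esub> h \<in> I" .
    moreover have "c \<odot>\<^bsub>F\<^esub> z = c \<odot>\<^bsub>F\<^esub> h \<oplus>\<^bsub>F\<^esub> c \<odot>\<^bsub>F\<^esub> x"
      using hc assms h(2) by (simp add: F.smult_r_distr complex_field_def)
    ultimately have "c \<odot>\<^bsub>F\<^esub> z \<in> I +>\<^bsub>F\<^esub> (c \<odot>\<^bsub>F\<^esub> x)"
      by (auto simp: a_r_coset_def')
    then show ?thesis
      using I.a_repr_independence' sc[OF assms(1)] by metis
  qed
  then show "c \<odot>\<^bsub>quot_algebra F I\<^esub> (I +>\<^bsub>F\<^esub> x) = I +>\<^bsub>F\<^esub> (c \<odot>\<^bsub>F\<^esub> x)"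
    unfolding quot_algebra_sel using I.a_rcos_self[OF assms(1)] by (intro SUP_eq_const) blast+
qed

lemma quot_algebra_carrier: "carrier (quot_algebra F I) = (\<lambda>x. I +>\<^bsub>F\<^esub> x) ` carrier F"
  by (auto simp: quot_algebra_sel FactRing_def A_RCOSETS_def')

lemma quot_algebra_assoc_algebra: "complex_assoc_algebra (quot_algebra F I)"
proof -
  interpret Q: ring "F Quot I" by (rule I.quotient_is_ring)
  have R: "ring (quot_algebra F I)"
  proof (rule ringI)
    show "abelian_group (quot_algebra F I)"
      by (rule abelian_groupI)
        (simp_all add: quot_algebra_sel Q.a_assoc Q.add.l_inv_ex, simp add: Q.a_comm)
    show "Group.monoid (quot_algebra F I)"
      by (rule monoidI) (simp_all add: quot_algebra_sel Q.m_assoc)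
  qed (simp_all add: quot_algebra_sel Q.l_distr Q.r_distr)
  note sel = quot_algebra_class_ops
  have UN: "c \<in> carrier complex_field" for c by (simp add: complex_field_def)
  have "module complex_field (quot_algebra F I)"
    by (rule moduleI[OF complex_field_cring ring.is_abelian_group[OF R]])
      (auto simp: quot_algebra_carrier sel UN F.smult_l_distr F.smult_r_distr F.smult_assoc1)
  then show ?thesis
    by (intro complex_assoc_algebra.intro complex_assoc_algebra_axioms.intro R)
      (auto simp: quot_algebra_carrier sel UN F.smult_mult_left F.smult_mult_right)
qed

end

definition presented_ideal :: "'a set \<Rightarrow> 'a ncpoly set \<Rightarrow> 'a ncpoly set" where
  "presented_ideal X S = genideal (free_algebra X) S"

definition presented_algebra ::
    "'a set \<Rightarrow> 'a ncpoly set \<Rightarrow> (complex, 'a ncpoly set) module" where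
  "presented_algebra X S = quot_algebra (free_algebra X) (presented_ideal X S)"

definition presented_gen :: "'a set \<Rightarrow> 'a ncpoly set \<Rightarrow> 'a \<Rightarrow> 'a ncpoly set" where
  "presented_gen X S x = presented_ideal X S +>\<^bsub>free_algebra X\<^esub> Var x"


section \<open>The two-parameter quantum coordinate ring\<close>

definition root_of_unity :: "complex \<Rightarrow> bool" where
  "root_of_unity z \<longleftrightarrow> (\<exists>m\<ge>1. z ^ m = 1)"

definition generic :: "complex \<Rightarrow> complex \<Rightarrow> bool" where
  "generic r s \<longleftrightarrow> r \<noteq> 0 \<and> s \<noteq> 0 \<and>
     \<not> root_of_unity r \<and> \<not> root_of_unity s \<and> \<not> root_of_unity (r / s)"

abbreviation index_pairs :: "nat \<Rightarrow> (nat \<times> nat) set" where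
  "index_pairs N \<equiv> {1..N} \<times> {1..N}"

definition qcoord_relations :: "complex \<Rightarrow> complex \<Rightarrow> nat \<Rightarrow> (nat \<times> nat) ncpoly set" where
  "qcoord_relations r s N = (let a = (\<lambda>i j. Var (i, j)) in
     {a i k * a i l - Const r * (a i l * a i k) | i k l.
        i \<in> {1..N} \<and> k \<in> {1..N} \<and> l \<in> {1..N} \<and> k < l}
   \<union> {a i k * a j k - Const (inverse s) * (a j k * a i k) | i j k.
        i \<in> {1..N} \<and> j \<in> {1..N} \<and> k \<in> {1..N} \<and> i < j}
   \<union> {Const r * (a i l * a j k) - Const (inverse s) * (a j k * a i l) | i j k l.
        i \<in> {1..N} \<and> j \<in> {1..N} \<and> k \<in> {1..N} \<and> l \<in> {1..N} \<and> i < j \<and> k < l}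
   \<union> {a i k * a j l - a j l * a i k - Const (r - s) * (a i l * a j k) | i j k l.
        i \<in> {1..N} \<and> j \<in> {1..N} \<and> k \<in> {1..N} \<and> l \<in> {1..N} \<and> i < j \<and> k < l})"

definition qcoord :: "complex \<Rightarrow> complex \<Rightarrow> nat \<Rightarrow> (complex, (nat \<times> nat) ncpoly set) module" where
  "qcoord r s N = presented_algebra (index_pairs N) (qcoord_relations r s N)"

lemma qcoord_relations_carrier:
  "qcoord_relations r s N \<subseteq> carrier (free_algebra (index_pairs N))"
proof -
  interpret F: complex_assoc_algebra "free_algebra (index_pairs N)"
    by (rule free_algebra_assoc_algebra)
  have diff: "p - q \<in> carrier (free_algebra (index_pairs N))"
    if "p \<in> carrier (free_algebra (index_pairs N))" "q \<in> carrier (free_algebra (index_pairs N))"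
    for p q
    using that keys_diff[of p q] by (auto simp: free_algebra_def)
  have "Var (i, j) \<in> carrier (free_algebra (index_pairs N))"
    if "i \<in> {1..N}" "j \<in> {1..N}" for i j
    using that by (simp add: free_algebra_def)
  then show ?thesis
    unfolding qcoord_relations_def Let_def
    by (intro Un_least subsetI; elim CollectE exE conjE; hypsubst)
      (intro diff mult_in_carrier Const_in_carrier; simp)+
qed

lemma qcoord_assoc_algebra: "complex_assoc_algebra (qcoord r s N)"
  unfolding qcoord_def presented_algebra_def presented_ideal_def
  by (intro quot_algebra_assoc_algebra free_algebra_assoc_algebra ring.genideal_ideal
      free_algebra_ring qcoord_relations_carrier)

definition qgen :: "complex \<Rightarrow> complex \<Rightarrow> nat \<Rightarrow> nat \<Rightarrow> nat \<Rightarrow> (nat \<times> nat) ncpoly set" where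
  "qgen r s N i j = presented_gen (index_pairs N) (qcoord_relations r s N) (i, j)"


section \<open>Matrices, quantum determinants and quantum Pfaffians\<close>

text \<open>An \<open>N \<times> N\<close> matrix is a function of two indices, of which only the values on
  \<open>{1..N}\<close> matter. Because the entries do not commute, products of families are
  products of lists, taken from left to right.\<close>

type_synonym 'b mat = "nat \<Rightarrow> nat \<Rightarrow> 'b"

definition mat_transpose :: "'b mat \<Rightarrow> 'b mat" where
  "mat_transpose X = (\<lambda>i j. X j i)"

definition mat_mult :: "('b, 'm) ring_scheme \<Rightarrow> nat \<Rightarrow> 'b mat \<Rightarrow> 'b mat \<Rightarrow> 'b mat" where
  "mat_mult M N X Y = (\<lambda>i j. \<Oplus>\<^bsub>M\<^esub>k\<in>{1..N}. X i k \<otimes>\<^bsub>M\<^esub> Y k j)"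

text \<open>The block-diagonal matrix with all blocks equal to \<open>J\<^sub>v\<close>; block \<open>m\<close> occupies the
  rows and columns \<open>2m - 1\<close> and \<open>2m\<close>.\<close>

definition block_J :: "complex \<Rightarrow> complex mat" where
  "block_J v = (\<lambda>i j. if odd i \<and> j = i + 1 then 1 else if even i \<and> i = j + 1 then - v else 0)"

definition scalar_mat :: "(complex, 'b, 'm) module_scheme \<Rightarrow> complex mat \<Rightarrow> 'b mat" where
  "scalar_mat M C = (\<lambda>i j. C i j \<odot>\<^bsub>M\<^esub> \<one>\<^bsub>M\<^esub>)"

definition list_prod :: "('b, 'm) monoid_scheme \<Rightarrow> 'b list \<Rightarrow> 'b" where
  "list_prod M xs = foldr (mult M) xs (one M)"

definition inversions :: "nat \<Rightarrow> (nat \<Rightarrow> nat) \<Rightarrow> nat" where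
  "inversions N \<sigma> = card {(i, j). i \<in> {1..N} \<and> j \<in> {1..N} \<and> i < j \<and> \<sigma> i > \<sigma> j}"

definition rdet :: "(complex, 'b, 'm) module_scheme \<Rightarrow> complex \<Rightarrow> nat \<Rightarrow> 'b mat \<Rightarrow> 'b" where
  "rdet M r N A = (\<Oplus>\<^bsub>M\<^esub>\<sigma>\<in>{\<sigma>. \<sigma> permutes {1..N}}.
     (- r) ^ inversions N \<sigma> \<odot>\<^bsub>M\<^esub> list_prod M (map (\<lambda>i. A i (\<sigma> i)) [1..<N + 1]))"

definition qint :: "complex \<Rightarrow> nat \<Rightarrow> complex" where
  "qint u k = (\<Sum>i<k. u ^ i)"

definition qfact :: "complex \<Rightarrow> nat \<Rightarrow> complex" where
  "qfact u n = (\<Prod>k=1..n. qint u k)"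

definition pfaffian_perms :: "nat \<Rightarrow> (nat \<Rightarrow> nat) set" where
  "pfaffian_perms n = {\<sigma>. \<sigma> permutes {1..2 * n} \<and> (\<forall>i\<in>{1..n}. \<sigma> (2 * i - 1) < \<sigma> (2 * i))}"

definition qPf :: "(complex, 'b, 'm) module_scheme \<Rightarrow> complex \<Rightarrow> nat \<Rightarrow> 'b mat \<Rightarrow> 'b" where
  "qPf M v n B = (1 / qfact (v ^ 4) n) \<odot>\<^bsub>M\<^esub>
     (\<Oplus>\<^bsub>M\<^esub>\<sigma>\<in>pfaffian_perms n. (- v) ^ inversions (2 * n) \<sigma> \<odot>\<^bsub>M\<^esub>
        list_prod M (map (\<lambda>i. B (\<sigma> (2 * i - 1)) (\<sigma> (2 * i))) [1..<n + 1]))"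

end

theory Submission
  imports Defs
begin

text \<open>Adjoin generators \<open>x\<^sub>1, \<dots>, x\<^sub>N\<close> that commute with the \<open>a\<^sub>i\<^sub>j\<close>, square to zero and satisfy
  \<open>x\<^sub>j x\<^sub>i = - r x\<^sub>i x\<^sub>j\<close> for \<open>i < j\<close>. The row forms \<open>\<omega>\<^sub>i = \<Sum>\<^sub>j a\<^sub>i\<^sub>j x\<^sub>j\<close> then satisfy the same relations,
  so the products \<open>y\<^sub>m\<close> of \<open>\<omega>\<^bsub>2m-1\<^esub>\<close> and \<open>\<omega>\<^bsub>2m\<^esub>\<close> square to zero and satisfy \<open>y\<^sub>l y\<^sub>m = r\<^sup>4 y\<^sub>m y\<^sub>l\<close>
  for \<open>m < l\<close>. Since \<open>\<Sum>\<^bsub>i<j\<^esub> b\<^sub>i\<^sub>j x\<^sub>i x\<^sub>j = \<Sum>\<^sub>m y\<^sub>m\<close>, the top coefficient of the \<open>n\<close>-th power of this form is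
  the unnormalised Pfaffian on the one hand, and \<open>\<Sum>\<^sub>\<sigma> r\<^bsup>4l(\<sigma>)\<^esup> = [n]\<^bsub>r^4\<^esub>!\<close> times the row-determinant on
  the other. Only top coefficients of products of row forms are needed (\<open>row_det w\<close> is that of
  \<open>\<omega>\<^bsub>w(1)\<^esub> \<dots> \<omega>\<^bsub>w(N)\<^esub>\<close>), so the exterior algebra itself is not constructed.\<close>


section \<open>Inversions and adjacent transpositions\<close>

abbreviation adj :: "nat \<Rightarrow> nat \<Rightarrow> nat" where
  "adj k \<equiv> transpose k (Suc k)"

text \<open>Applying \<open>adj k\<close> to both positions carries inversions to inversions, and
  \<open>(k, Suc k)\<close> is the only one gained. \<open>\<sigma>\<close> may be any map, because
  straightening also meets index maps with repeated values.\<close>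

lemma inversions_comp_adj:
  assumes "1 \<le> k" "k < N" "\<sigma> k < \<sigma> (Suc k)"
  shows "inversions N (\<sigma> \<circ> adj k) = Suc (inversions N \<sigma>)"
proof -
  define Inv where
    "Inv \<rho> = {(i, j). i \<in> {1..N} \<and> j \<in> {1..N} \<and> i < j \<and> \<rho> i > \<rho> j}" for \<rho> :: "nat \<Rightarrow> nat"
  have fin: "finite (Inv \<rho>)" for \<rho>
    by (rule finite_subset[of _ "{1..N} \<times> {1..N}"]) (auto simp: Inv_def)
  \<comment> \<open>Among increasing pairs of positions only \<open>(k, Suc k)\<close> is reversed
    by \<open>adj k\<close>. A general \<open>\<rho>\<close> serves both inclusions, since composing
    twice with \<open>adj k\<close> gives back \<open>\<sigma>\<close>.\<close>
  have mono: "map_prod (adj k) (adj k) p \<in> Inv (\<rho> \<circ> adj k)"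
    if "p \<in> Inv \<rho>" "p \<noteq> (k, Suc k)" for \<rho> p
    using that assms by (cases p) (auto simp: Inv_def transpose_def)
  have invol: "map_prod (adj k) (adj k) (map_prod (adj k) (adj k) p) = p" for p
    by (cases p) simp
  have "Inv (\<sigma> \<circ> adj k) = insert (k, Suc k) (map_prod (adj k) (adj k) ` Inv \<sigma>)"
  proof (intro equalityI subsetI)
    fix p assume p: "p \<in> Inv (\<sigma> \<circ> adj k)"
    show "p \<in> insert (k, Suc k) (map_prod (adj k) (adj k) ` Inv \<sigma>)"
    proof (cases "p = (k, Suc k)")
      case False
      from mono[OF p False] have "map_prod (adj k) (adj k) p \<in> Inv \<sigma>"
        by (simp add: comp_assoc)
      then show ?thesis using invol by (metis imageI insertCI)
    qed simp
  next
    fix p assume "p \<in> insert (k, Suc k) (map_prod (adj k) (adj k) ` Inv \<sigma>)"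
    moreover have "(k, Suc k) \<notin> Inv \<sigma>" "(k, Suc k) \<in> Inv (\<sigma> \<circ> adj k)"
      using assms by (auto simp: Inv_def)
    ultimately show "p \<in> Inv (\<sigma> \<circ> adj k)"
      using mono[of _ \<sigma>] by (metis imageE insertE)
  qed
  moreover have "(k, Suc k) \<notin> map_prod (adj k) (adj k) ` Inv \<sigma>"
    using invol by (auto simp: Inv_def transpose_def split: if_splits)
  moreover have "inj (map_prod (adj k) (adj k))"
    by (intro prod.inj_map inj_transpose)
  ultimately have "card (Inv (\<sigma> \<circ> adj k)) = Suc (card (Inv \<sigma>))"
    using fin by (simp add: card_image inj_on_subset)
  then show ?thesis
    by (simp add: inversions_def Inv_def)
qed

text \<open>A map with an ascent at \<open>k\<close> is paired with its composite with
  \<open>adj k\<close>, whose weight has one more factor \<open>t\<close>. For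
  \<open>t = Const (- r)\<close> the bracket will produce a quantum minor.\<close>

lemma sum_pair_adj:
  fixes t :: "'b::ring_1"
  assumes k: "1 \<le> k" "k < N" and fin: "finite S"
    and closed: "\<And>\<sigma>. \<sigma> \<in> S \<Longrightarrow> \<sigma> \<circ> adj k \<in> S"
    and neq: "\<And>\<sigma>. \<sigma> \<in> S \<Longrightarrow> \<sigma> k \<noteq> \<sigma> (Suc k)"
  shows "(\<Sum>\<sigma>\<in>S. t ^ inversions N \<sigma> * F \<sigma>) =
    (\<Sum>\<sigma>\<in>{\<sigma> \<in> S. \<sigma> k < \<sigma> (Suc k)}. t ^ inversions N \<sigma> * (F \<sigma> + t * F (\<sigma> \<circ> adj k)))"
proof -
  let ?U = "{\<sigma> \<in> S. \<sigma> k < \<sigma> (Suc k)}" and ?L = "{\<sigma> \<in> S. \<sigma> (Suc k) < \<sigma> k}"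
  have "S = ?U \<union> ?L"
    using neq by (auto simp: neq_iff)
  then have "(\<Sum>\<sigma>\<in>S. t ^ inversions N \<sigma> * F \<sigma>) =
      (\<Sum>\<sigma>\<in>?U. t ^ inversions N \<sigma> * F \<sigma>) + (\<Sum>\<sigma>\<in>?L. t ^ inversions N \<sigma> * F \<sigma>)"
    using fin by (subst sum.union_disjoint[symmetric]) auto
  also have "(\<Sum>\<sigma>\<in>?L. t ^ inversions N \<sigma> * F \<sigma>) =
      (\<Sum>\<sigma>\<in>?U. t ^ inversions N (\<sigma> \<circ> adj k) * F (\<sigma> \<circ> adj k))"
    by (rule sum.reindex_bij_witness[of _ "\<lambda>\<sigma>. \<sigma> \<circ> adj k" "\<lambda>\<sigma>. \<sigma> \<circ> adj k"])
      (use closed in \<open>auto simp: comp_assoc\<close>)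
  also have "\<dots> = (\<Sum>\<sigma>\<in>?U. t ^ inversions N \<sigma> * (t * F (\<sigma> \<circ> adj k)))"
    using k by (intro sum.cong)
      (auto simp: inversions_comp_adj power_commutes mult.assoc[symmetric])
  finally show ?thesis
    by (simp add: distrib_left sum.distrib)
qed

text \<open>Permutations are sorted by the position of the largest value. Moving it one place to the
  left costs a factor \<open>q\<close>, so the induction step multiplies by
  \<open>1 + q + ... + q^n\<close>.\<close>

lemma sum_power_inversions:
  "(\<Sum>\<sigma> | \<sigma> permutes {1..n}. q ^ inversions n \<sigma>) = qfact q n"
proof (induction n)
  case 0
  then show ?case by (simp add: inversions_def qfact_def)
next
  case (Suc n)
  define P where "P p = {\<sigma>. \<sigma> permutes {1..Suc n} \<and> \<sigma> p = Suc n}" for p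
  define W where "W p = (\<Sum>\<sigma>\<in>P p. q ^ inversions (Suc n) \<sigma>)" for p
  have last: "P (Suc n) = {\<sigma>. \<sigma> permutes {1..n}}"
  proof (intro equalityI subsetI)
    fix \<sigma> assume "\<sigma> \<in> P (Suc n)"
    then show "\<sigma> \<in> {\<sigma>. \<sigma> permutes {1..n}}"
      using permutes_superset[of \<sigma> "{1..Suc n}" "{1..n}"] by (auto simp: P_def le_Suc_eq)
  next
    fix \<sigma> assume "\<sigma> \<in> {\<sigma>. \<sigma> permutes {1..n}}"
    then show "\<sigma> \<in> P (Suc n)"
      using permutes_subset[of \<sigma> "{1..n}" "{1..Suc n}"] permutes_not_in[of \<sigma> "{1..n}" "Suc n"]
      by (auto simp: P_def)
  qed
  \<comment> \<open>The largest value in the last position takes part in no inversion.\<close>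
  have "inversions (Suc n) \<sigma> = inversions n \<sigma>" if "\<sigma> permutes {1..n}" for \<sigma>
  proof -
    have "\<sigma> (Suc n) = Suc n" and "\<And>i. i \<in> {1..n} \<Longrightarrow> \<sigma> i \<in> {1..n}"
      using that permutes_not_in[OF that, of "Suc n"] by (simp_all only: permutes_in_image) auto
    then have "j \<noteq> Suc n" if "i \<in> {1..Suc n}" "i < j" "j \<le> Suc n" "\<sigma> i > \<sigma> j" for i j
      using that by fastforce
    then have "{(i, j). i \<in> {1..Suc n} \<and> j \<in> {1..Suc n} \<and> i < j \<and> \<sigma> i > \<sigma> j} =
        {(i, j). i \<in> {1..n} \<and> j \<in> {1..n} \<and> i < j \<and> \<sigma> i > \<sigma> j}"
      by (fastforce simp: le_Suc_eq)
    then show ?thesis by (simp add: inversions_def)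
  qed
  then have W_last: "W (Suc n) = qfact q n"
    unfolding W_def last Suc.IH[symmetric] by simp
  \<comment> \<open>Exchanging positions \<open>p\<close> and \<open>Suc p\<close> matches
    \<open>P (Suc p)\<close> with \<open>P p\<close>; the maximum at \<open>Suc p\<close> makes
    \<open>p\<close> an ascent.\<close>
  have step: "W p = q * W (Suc p)" if "1 \<le> p" "p \<le> n" for p
  proof -
    have lt: "\<sigma> p < \<sigma> (Suc p)" if "\<sigma> \<in> P (Suc p)" for \<sigma>
    proof -
      have \<sigma>: "\<sigma> permutes {1..Suc n}" "\<sigma> (Suc p) = Suc n" using that by (auto simp: P_def)
      have "\<sigma> p \<noteq> \<sigma> (Suc p)"
        by (simp add: inj_eq[OF permutes_inj[OF \<sigma>(1)]])
      moreover have "\<sigma> p \<le> Suc n"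
        using permutes_in_image[OF \<sigma>(1), of p] that \<open>1 \<le> p\<close> \<open>p \<le> n\<close> by simp
      ultimately show ?thesis
        using \<sigma>(2) by simp
    qed
    have perm: "\<sigma> \<circ> adj p permutes {1..Suc n}" if "\<sigma> permutes {1..Suc n}" for \<sigma>
      using that \<open>1 \<le> p\<close> \<open>p \<le> n\<close> by (intro permutes_compose permutes_swap_id) auto
    have "W p = (\<Sum>\<sigma>\<in>P (Suc p). q ^ inversions (Suc n) (\<sigma> \<circ> adj p))"
      unfolding W_def
      by (rule sum.reindex_bij_witness[of _ "\<lambda>\<sigma>. \<sigma> \<circ> adj p" "\<lambda>\<sigma>. \<sigma> \<circ> adj p"])
        (use perm in \<open>auto simp: P_def comp_assoc\<close>)
    also have "\<dots> = q * W (Suc p)"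
      using that lt by (simp add: W_def inversions_comp_adj sum_distrib_left)
    finally show ?thesis .
  qed
  \<comment> \<open>Here \<open>d\<close> is the distance of the maximum from the last
    position.\<close>
  have "W (Suc n - d) = q ^ d * qfact q n" if "d \<le> n" for d
    using that
  proof (induction d)
    case (Suc d)
    then show ?case using step[of "n - d"] by (simp add: Suc_diff_le)
  qed (simp add: W_last)
  then have "(\<Sum>d\<le>n. W (Suc n - d)) = (\<Sum>d\<le>n. q ^ d) * qfact q n"
    by (simp add: sum_distrib_right)
  also have "(\<Sum>d\<le>n. W (Suc n - d)) = (\<Sum>p\<in>{1..Suc n}. W p)"
    by (rule sum.reindex_bij_witness[of _ "\<lambda>p. Suc n - p" "\<lambda>d. Suc n - d"]) auto
  also have "\<dots> = (\<Sum>\<sigma> | \<sigma> permutes {1..Suc n}. q ^ inversions (Suc n) \<sigma>)"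
  proof -
    have fin: "finite {\<sigma>. \<sigma> permutes {1..Suc n}}" by (simp add: finite_permutations)
    have "inv_into UNIV \<sigma> (Suc n) \<in> {1..Suc n}" if "\<sigma> permutes {1..Suc n}" for \<sigma>
      using permutes_in_image[OF permutes_inv[OF that]] by simp
    then have "(\<Sum>\<sigma> | \<sigma> permutes {1..Suc n}. q ^ inversions (Suc n) \<sigma>) =
        (\<Sum>p\<in>{1..Suc n}. \<Sum>\<sigma> | \<sigma> \<in> {\<sigma>. \<sigma> permutes {1..Suc n}} \<and> inv_into UNIV \<sigma> (Suc n) = p.
          q ^ inversions (Suc n) \<sigma>)"
      using fin by (intro sum.group[symmetric]) auto
    moreover have "{\<sigma>. \<sigma> \<in> {\<sigma>. \<sigma> permutes {1..Suc n}} \<and> inv_into UNIV \<sigma> (Suc n) = p} = P p" for p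
      by (auto simp: P_def permutes_inv_eq permutes_inverses)
    ultimately show ?thesis by (simp add: W_def)
  qed
  finally show ?case
    by (simp add: qfact_def qint_def lessThan_Suc_atMost mult.commute)
qed

text \<open>Distributivity when the order of the factors matters. Distinctness lets a choice of
  summands be a function of the list entry instead of the position.\<close>

lemma prod_list_sum:
  fixes f :: "'i \<Rightarrow> 'j \<Rightarrow> 'b::semiring_1"
  assumes "distinct xs" "finite A"
  shows "prod_list (map (\<lambda>i. \<Sum>m\<in>A. f i m) xs) =
    (\<Sum>g\<in>set xs \<rightarrow>\<^sub>E A. prod_list (map (\<lambda>i. f i (g i)) xs))"
  using assms(1)
proof (induction xs)
  case (Cons x xs)
  \<comment> \<open>A choice function is split into its value at \<open>x\<close> and its part on
    \<open>xs\<close>. As \<open>x\<close> does not occur in \<open>xs\<close>, the splitting is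
    injective and the update at \<open>x\<close> leaves the later factors alone.\<close>
  have "(\<Sum>g\<in>set (x # xs) \<rightarrow>\<^sub>E A. prod_list (map (\<lambda>i. f i (g i)) (x # xs))) =
      (\<Sum>(m, g)\<in>A \<times> (set xs \<rightarrow>\<^sub>E A). prod_list (map (\<lambda>i. f i ((g(x := m)) i)) (x # xs)))"
    using Cons.prems inj_combinator[of x "set xs" "\<lambda>_. A"]
    by (simp only: list.set PiE_insert_eq, subst sum.reindex) (auto simp: case_prod_unfold)
  also have "\<dots> = (\<Sum>(m, g)\<in>A \<times> (set xs \<rightarrow>\<^sub>E A). f x m * prod_list (map (\<lambda>i. f i (g i)) xs))"
    using Cons.prems
    by (intro sum.cong refl)
      (auto intro!: arg_cong[of _ _ prod_list] map_cong arg_cong[of _ _ "(*) _"])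
  also have "\<dots> = (\<Sum>m\<in>A. f x m) * (\<Sum>g\<in>set xs \<rightarrow>\<^sub>E A. prod_list (map (\<lambda>i. f i (g i)) xs))"
    by (simp add: sum_product sum.cartesian_product)
  finally show ?case
    using Cons by simp
qed simp


section \<open>Congruence modulo the defining relations\<close>

lemma Const_mult_Const: "Const c * Const d = (Const (c * d) :: 'a ncpoly)"
  by (simp add: mult_single)

lemma Const_power: "Const c ^ k = (Const (c ^ k) :: 'a ncpoly)"
  by (induction k) (simp_all add: mult_single)

lemma Const_sum: "Const (\<Sum>x\<in>S. c x) = (\<Sum>x\<in>S. Const (c x) :: 'a ncpoly)"
  by (induction S rule: infinite_finite_induct) (simp_all add: single_add)

lemma Const_left_commute: "p * (Const c * q) = Const c * (p * q)" for p q :: "'a ncpoly"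
  by (metis Const_commute mult.assoc)

locale qcoord_cong =
  fixes r s :: complex and N :: nat
  assumes s_nonzero: "s \<noteq> 0"
begin

definition C :: "(nat \<times> nat) ncpoly set" where
  "C = carrier (free_algebra (index_pairs N))"

definition I :: "(nat \<times> nat) ncpoly set" where
  "I = presented_ideal (index_pairs N) (qcoord_relations r s N)"

text \<open>Computing with polynomials up to \<open>\<approx>\<close> instead of with cosets keeps
  ordinary ring arithmetic available; cosets return only at the end.\<close>

definition cong :: "(nat \<times> nat) ncpoly \<Rightarrow> (nat \<times> nat) ncpoly \<Rightarrow> bool" (infix \<open>\<approx>\<close> 50) where
  "p \<approx> q \<longleftrightarrow> p - q \<in> I"

lemma C_mult [intro]: "p \<in> C \<Longrightarrow> q \<in> C \<Longrightarrow> p * q \<in> C"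
  unfolding C_def by (rule mult_in_carrier)

lemma C_Const [intro, simp]: "Const c \<in> C"
  unfolding C_def by (rule Const_in_carrier)

lemma C_zero [simp]: "0 \<in> C" and C_one [simp]: "1 \<in> C"
  using C_Const[of 0] C_Const[of 1] by simp_all

lemma C_add [intro]: "p \<in> C \<Longrightarrow> q \<in> C \<Longrightarrow> p + q \<in> C"
  unfolding C_def
  using ring.ring_simprules(1)[OF free_algebra_ring, of p "index_pairs N" q] by simp

lemma C_diff [intro]: "p \<in> C \<Longrightarrow> q \<in> C \<Longrightarrow> p - q \<in> C"
  using keys_diff[of p q] by (auto simp: C_def free_algebra_def)

lemma C_sum: "(\<And>x. x \<in> S \<Longrightarrow> f x \<in> C) \<Longrightarrow> sum f S \<in> C"
  by (induction S rule: infinite_finite_induct) auto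

lemma C_prod_list: "(\<And>p. p \<in> set ps \<Longrightarrow> p \<in> C) \<Longrightarrow> prod_list ps \<in> C"
  by (induction ps) auto

lemma C_Var: "i \<in> {1..N} \<Longrightarrow> j \<in> {1..N} \<Longrightarrow> Var (i, j) \<in> C"
  by (simp add: C_def free_algebra_def)

lemma ideal_I: "ideal I (free_algebra (index_pairs N))"
  unfolding I_def presented_ideal_def
  by (intro ring.genideal_ideal free_algebra_ring qcoord_relations_carrier)

lemma relation_in_I: "p \<in> qcoord_relations r s N \<Longrightarrow> p \<in> I"
  unfolding I_def presented_ideal_def
  using ring.genideal_self[OF free_algebra_ring qcoord_relations_carrier] by blast

lemma I_add: "p \<in> I \<Longrightarrow> q \<in> I \<Longrightarrow> p + q \<in> I"
  using additive_subgroup.a_closed[OF ideal.axioms(1)[OF ideal_I], of p q] by simp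

lemma I_zero: "0 \<in> I"
  using additive_subgroup.zero_closed[OF ideal.axioms(1)[OF ideal_I]] by simp

lemma I_mult_left: "p \<in> C \<Longrightarrow> q \<in> I \<Longrightarrow> p * q \<in> I"
  using ideal.I_l_closed[OF ideal_I, of q p] by (simp add: C_def)

lemma I_mult_right: "p \<in> I \<Longrightarrow> q \<in> C \<Longrightarrow> p * q \<in> I"
  using ideal.I_r_closed[OF ideal_I, of p q] by (simp add: C_def)

lemma cong_refl [simp]: "p \<approx> p"
  by (simp add: cong_def I_zero)

lemma cong_trans [trans]: "p \<approx> q \<Longrightarrow> q \<approx> u \<Longrightarrow> p \<approx> u"
  unfolding cong_def using I_add[of "p - q" "q - u"] by simp

lemma cong_add: "p \<approx> q \<Longrightarrow> p' \<approx> q' \<Longrightarrow> p + p' \<approx> q + q'"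
  unfolding cong_def using I_add[of "p - q" "p' - q'"] by (simp add: algebra_simps)

text \<open>The telescoping \<open>p * (p' - q') + (p - q) * q'\<close> explains why just
  \<open>p\<close> and \<open>q'\<close> have to lie in the carrier.\<close>

lemma cong_mult:
  assumes "p \<approx> q" "p' \<approx> q'" "p \<in> C" "q' \<in> C"
  shows "p * p' \<approx> q * q'"
proof -
  have "p * p' - q * q' = p * (p' - q') + (p - q) * q'"
    by (simp add: algebra_simps)
  then show ?thesis
    using assms unfolding cong_def by (auto intro: I_add I_mult_left I_mult_right)
qed

lemma cong_mult_left: "p \<in> C \<Longrightarrow> q \<approx> q' \<Longrightarrow> p * q \<approx> p * q'"
  unfolding cong_def right_diff_distrib[symmetric] by (rule I_mult_left)

lemma cong_mult_right: "p \<in> C \<Longrightarrow> q \<approx> q' \<Longrightarrow> q * p \<approx> q' * p"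
  unfolding cong_def left_diff_distrib[symmetric] by (rule I_mult_right)

lemma cong_sum: "(\<And>x. x \<in> S \<Longrightarrow> f x \<approx> g x) \<Longrightarrow> sum f S \<approx> sum g S"
  by (induction S rule: infinite_finite_induct) (auto intro: cong_add)

lemma cong_prod_list:
  assumes "\<And>x. x \<in> set xs \<Longrightarrow> f x \<approx> g x \<and> f x \<in> C \<and> g x \<in> C"
  shows "prod_list (map f xs) \<approx> prod_list (map g xs)"
  using assms by (induction xs) (auto intro!: cong_mult C_prod_list)

section \<open>Quantum minors of size two\<close>

text \<open>For \<open>k < l\<close> this is the coefficient of \<open>x_k x_l\<close> in the
  product of the row forms \<open>\<omega>_i\<close> and \<open>\<omega>_j\<close>.\<close>

definition minor :: "nat \<Rightarrow> nat \<Rightarrow> nat \<Rightarrow> nat \<Rightarrow> (nat \<times> nat) ncpoly" where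
  "minor i j k l = Var (i, k) * Var (j, l) - Const r * (Var (i, l) * Var (j, k))"

lemma minor_in_C: "i \<in> {1..N} \<Longrightarrow> j \<in> {1..N} \<Longrightarrow> k \<in> {1..N} \<Longrightarrow> l \<in> {1..N} \<Longrightarrow> minor i j k l \<in> C"
  unfolding minor_def by (intro C_diff C_mult C_Const C_Var)

text \<open>This is the defining relation within one row; it expresses that
  \<open>\<omega>_i\<close> squares to zero.\<close>

lemma minor_same_row:
  assumes "i \<in> {1..N}" "k \<in> {1..N}" "l \<in> {1..N}" "k < l"
  shows "minor i i k l \<approx> 0"
  unfolding cong_def diff_zero minor_def
  by (rule relation_in_I) (use assms in \<open>unfold qcoord_relations_def Let_def, blast\<close>)

text \<open>The relation that trades \<open>inverse s\<close> for \<open>r\<close>. It is needed for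
  exchanging rows and again for rewriting the entries of the form.\<close>

lemma column_relation:
  assumes "i \<in> {1..N}" "j \<in> {1..N}" "k \<in> {1..N}" "l \<in> {1..N}" "i < j" "k < l"
  shows "Const r * (Var (i, l) * Var (j, k)) \<approx> Const (inverse s) * (Var (j, k) * Var (i, l))"
  unfolding cong_def
  by (rule relation_in_I) (use assms in \<open>unfold qcoord_relations_def Let_def, blast\<close>)

text \<open>The difference of the two sides is \<open>r\<close> times the fourth defining relation
  minus \<open>s\<close> times the third, so \<open>s\<close> cancels. In terms of row forms,
  \<open>\<omega>_j \<omega>_i = - r \<omega>_i \<omega>_j\<close> for \<open>i < j\<close>.\<close>

lemma minor_swap_rows:
  assumes "i \<in> {1..N}" "j \<in> {1..N}" "k \<in> {1..N}" "l \<in> {1..N}" "i < j" "k < l"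
  shows "minor j i k l \<approx> Const (- r) * minor i j k l"
proof -
  let ?X = "Var (i, k) * Var (j, l) :: (nat \<times> nat) ncpoly"
  let ?X' = "Var (j, l) * Var (i, k) :: (nat \<times> nat) ncpoly"
  let ?Y = "Var (i, l) * Var (j, k) :: (nat \<times> nat) ncpoly"
  let ?Y' = "Var (j, k) * Var (i, l) :: (nat \<times> nat) ncpoly"
  have "?X - ?X' - Const (r - s) * ?Y \<in> I"
    by (rule relation_in_I) (use assms in \<open>unfold qcoord_relations_def Let_def, blast\<close>)
  then have 1: "Const r * (?X - ?X' - Const (r - s) * ?Y) \<in> I"
    by (intro I_mult_left C_Const)
  have "Const (- s) * (Const r * ?Y - Const (inverse s) * ?Y') \<in> I"
    using column_relation[OF assms] unfolding cong_def by (intro I_mult_left C_Const)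
  with 1 have "Const r * (?X - ?X' - Const (r - s) * ?Y) +
      Const (- s) * (Const r * ?Y - Const (inverse s) * ?Y') \<in> I"
    by (rule I_add)
  also have "Const (- s) * (Const r * ?Y - Const (inverse s) * ?Y') = ?Y' - Const (r * s) * ?Y"
    using s_nonzero
    by (simp add: right_diff_distrib mult.assoc[symmetric] Const_mult_Const single_uminus
        mult.commute[of s r])
  also have "Const r * (?X - ?X' - Const (r - s) * ?Y) + (?Y' - Const (r * s) * ?Y) =
      minor j i k l - Const (- r) * minor i j k l"
    by (simp add: minor_def right_diff_distrib mult.assoc[symmetric] Const_mult_Const single_diff
        single_uminus left_diff_distrib)
  finally show ?thesis
    by (simp add: cong_def)
qed

end


section \<open>Determinants with prescribed rows\<close>

lemma prod_list_upt_split: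
  fixes f :: "nat \<Rightarrow> 'b::monoid_mult"
  assumes "1 \<le> k" "k < N"
  shows "prod_list (map f [1..<N + 1]) =
    prod_list (map f [1..<k]) * (f k * f (Suc k)) * prod_list (map f [k + 2..<N + 1])"
proof -
  have "[1..<N + 1] = [1..<k] @ k # Suc k # [k + 2..<N + 1]"
    using assms upt_add_eq_append[of 1 k "N + 1 - k"] by (simp add: upt_conv_Cons)
  then show ?thesis by (simp add: mult.assoc)
qed

lemma prod_list_upt_pairs:
  fixes f :: "nat \<Rightarrow> 'b::monoid_mult"
  shows "prod_list (map (\<lambda>i. f (2 * i - 1) * f (2 * i)) [1..<n + 1]) =
    prod_list (map f [1..<2 * n + 1])"
  by (induction n) (simp_all add: mult.assoc)

lemma adj_apply: "i < k \<Longrightarrow> adj k i = i" "Suc k < i \<Longrightarrow> adj k i = i"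
  by (simp_all add: transpose_def)

context qcoord_cong
begin

definition row_det :: "(nat \<Rightarrow> nat) \<Rightarrow> (nat \<times> nat) ncpoly" where
  "row_det w = (\<Sum>\<sigma> | \<sigma> permutes {1..N}. Const (- r) ^ inversions N \<sigma> *
     prod_list (map (\<lambda>k. Var (w k, \<sigma> k)) [1..<N + 1]))"

lemma row_det_cong: "(\<And>k. k \<in> {1..N} \<Longrightarrow> w k = w' k) \<Longrightarrow> row_det w = row_det w'"
  unfolding row_det_def
  by (intro sum.cong refl arg_cong2[of _ _ _ _ "(*)"] arg_cong[of _ _ prod_list] map_cong) auto

lemma C_Const_power [intro, simp]: "Const c ^ k \<in> C"
  by (simp add: Const_power)

lemma perm_in_range: "\<sigma> permutes {1..N} \<Longrightarrow> k \<in> {1..N} \<Longrightarrow> \<sigma> k \<in> {1..N}"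
  by (simp only: permutes_in_image)

lemma prod_list_Var_in_C:
  assumes "\<And>k. k \<in> {1..N} \<Longrightarrow> w k \<in> {1..N}" "\<sigma> permutes {1..N}" "set xs \<subseteq> {1..N}"
  shows "prod_list (map (\<lambda>i. Var (w i, \<sigma> i)) xs) \<in> C"
proof (rule C_prod_list)
  fix p :: "(nat \<times> nat) ncpoly" assume "p \<in> set (map (\<lambda>i. Var (w i, \<sigma> i)) xs)"
  then obtain i where "p = Var (w i, \<sigma> i)" "i \<in> {1..N}"
    using assms(3) by auto
  then show "p \<in> C"
    using C_Var[OF assms(1) perm_in_range[OF assms(2)]] by simp
qed

lemma row_det_in_C:
  assumes "\<And>k. k \<in> {1..N} \<Longrightarrow> w k \<in> {1..N}"
  shows "row_det w \<in> C"
  unfolding row_det_def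
  by (intro C_sum C_mult C_Const_power prod_list_Var_in_C assms) auto

text \<open>Expansion along two neighbouring rows: pairing \<open>\<sigma>\<close> with
  \<open>\<sigma> \<circ> adj k\<close> changes two adjacent factors only, and these combine into a
  minor. Relations between minors thereby pass to determinants.\<close>

lemma row_det_pair:
  assumes k: "1 \<le> k" "k < N"
  shows "row_det w = (\<Sum>\<sigma>\<in>{\<sigma> \<in> {\<sigma>. \<sigma> permutes {1..N}}. \<sigma> k < \<sigma> (Suc k)}.
    Const (- r) ^ inversions N \<sigma> *
      (prod_list (map (\<lambda>i. Var (w i, \<sigma> i)) [1..<k]) *
       minor (w k) (w (Suc k)) (\<sigma> k) (\<sigma> (Suc k)) *
       prod_list (map (\<lambda>i. Var (w i, \<sigma> i)) [k + 2..<N + 1])))"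
proof -
  let ?F = "\<lambda>\<sigma>. prod_list (map (\<lambda>i. Var (w i, \<sigma> i)) [1..<N + 1]) :: (nat \<times> nat) ncpoly"
  have *: "?F \<sigma> + Const (- r) * ?F (\<sigma> \<circ> adj k) =
      prod_list (map (\<lambda>i. Var (w i, \<sigma> i)) [1..<k]) *
      minor (w k) (w (Suc k)) (\<sigma> k) (\<sigma> (Suc k)) *
      prod_list (map (\<lambda>i. Var (w i, \<sigma> i)) [k + 2..<N + 1])" for \<sigma>
  proof -
    have "map (\<lambda>i. Var (w i, (\<sigma> \<circ> adj k) i)) [1..<k] = (map (\<lambda>i. Var (w i, \<sigma> i)) [1..<k] :: (nat \<times> nat) ncpoly list)"
      "map (\<lambda>i. Var (w i, (\<sigma> \<circ> adj k) i)) [k + 2..<N + 1] =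
        (map (\<lambda>i. Var (w i, \<sigma> i)) [k + 2..<N + 1] :: (nat \<times> nat) ncpoly list)"
      by (auto simp: adj_apply)
    then show ?thesis
      unfolding prod_list_upt_split[OF k] minor_def
      by (simp only: comp_apply transpose_apply_first transpose_apply_second single_uminus
          mult_minus_left right_diff_distrib left_diff_distrib Const_left_commute mult.assoc) simp
  qed
  have neq: "\<sigma> k \<noteq> \<sigma> (Suc k)" if "\<sigma> permutes {1..N}" for \<sigma>
    by (simp add: inj_eq[OF permutes_inj[OF that]])
  show ?thesis
    unfolding row_det_def *[symmetric]
  proof (rule sum_pair_adj[OF k])
    show "finite {\<sigma>. \<sigma> permutes {1..N}}"
      by (simp add: finite_permutations)
    show "\<sigma> \<circ> adj k \<in> {\<sigma>. \<sigma> permutes {1..N}}" if "\<sigma> \<in> {\<sigma>. \<sigma> permutes {1..N}}" for \<sigma>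
      using that k by (auto intro!: permutes_compose permutes_swap_id)
  qed (use neq in auto)
qed

text \<open>Every minor in the expansion along rows \<open>k\<close> and \<open>Suc k\<close> has
  two equal rows.\<close>

lemma row_det_equal_rows:
  assumes k: "1 \<le> k" "k < N" and w: "\<And>k. k \<in> {1..N} \<Longrightarrow> w k \<in> {1..N}"
    and eq: "w k = w (Suc k)"
  shows "row_det w \<approx> 0"
proof -
  have "row_det w \<approx> (\<Sum>\<sigma>\<in>{\<sigma> \<in> {\<sigma>. \<sigma> permutes {1..N}}. \<sigma> k < \<sigma> (Suc k)}.
    Const (- r) ^ inversions N \<sigma> *
      (prod_list (map (\<lambda>i. Var (w i, \<sigma> i)) [1..<k]) * 0 *
       prod_list (map (\<lambda>i. Var (w i, \<sigma> i)) [k + 2..<N + 1])))"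
    unfolding row_det_pair[OF k] eq
  proof (intro cong_sum)
    fix \<sigma> assume "\<sigma> \<in> {\<sigma> \<in> {\<sigma>. \<sigma> permutes {1..N}}. \<sigma> k < \<sigma> (Suc k)}"
    then have \<sigma>: "\<sigma> permutes {1..N}" "\<sigma> k < \<sigma> (Suc k)" by simp_all
    have range: "\<sigma> k \<in> {1..N}" "\<sigma> (Suc k) \<in> {1..N}" "w k \<in> {1..N}" "w (Suc k) \<in> {1..N}"
      using k by (intro perm_in_range[OF \<sigma>(1)] w; simp)+
    have "prod_list (map (\<lambda>i. Var (w i, \<sigma> i)) [1..<k]) \<in> C"
      "prod_list (map (\<lambda>i. Var (w i, \<sigma> i)) [k + 2..<N + 1]) \<in> C"
      using k by (intro prod_list_Var_in_C w \<sigma>(1); auto)+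
    with minor_same_row[OF range(4,1,2) \<sigma>(2)] show "Const (- r) ^ inversions N \<sigma> *
      (prod_list (map (\<lambda>i. Var (w i, \<sigma> i)) [1..<k]) *
       minor (w (Suc k)) (w (Suc k)) (\<sigma> k) (\<sigma> (Suc k)) *
       prod_list (map (\<lambda>i. Var (w i, \<sigma> i)) [k + 2..<N + 1])) \<approx> Const (- r) ^ inversions N \<sigma> *
      (prod_list (map (\<lambda>i. Var (w i, \<sigma> i)) [1..<k]) *
       0 *
       prod_list (map (\<lambda>i. Var (w i, \<sigma> i)) [k + 2..<N + 1]))"
      by (intro cong_mult_left cong_mult_right C_Const_power)
  qed
  then show ?thesis by simp
qed

text \<open>Every minor in the expansion along rows \<open>k\<close> and \<open>Suc k\<close>
  contributes the same factor \<open>- r\<close>, and constants are central.\<close>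

lemma row_det_swap_rows:
  assumes k: "1 \<le> k" "k < N" and w: "\<And>k. k \<in> {1..N} \<Longrightarrow> w k \<in> {1..N}"
    and less: "w k < w (Suc k)"
  shows "row_det (w \<circ> adj k) \<approx> Const (- r) * row_det w"
proof -
  \<comment> \<open>The factors outside the two rows do not see the transposition.\<close>
  have map1: "map (\<lambda>i. Var ((w \<circ> adj k) i, \<sigma> i)) [1..<k] = (map (\<lambda>i. Var (w i, \<sigma> i)) [1..<k] :: (nat \<times> nat) ncpoly list)"
    and map2: "map (\<lambda>i. Var ((w \<circ> adj k) i, \<sigma> i)) [k + 2..<N + 1] =
      (map (\<lambda>i. Var (w i, \<sigma> i)) [k + 2..<N + 1] :: (nat \<times> nat) ncpoly list)" for \<sigma>
    by (auto simp: adj_apply)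
  have "row_det (w \<circ> adj k) \<approx> (\<Sum>\<sigma>\<in>{\<sigma> \<in> {\<sigma>. \<sigma> permutes {1..N}}. \<sigma> k < \<sigma> (Suc k)}.
    Const (- r) ^ inversions N \<sigma> *
      (prod_list (map (\<lambda>i. Var (w i, \<sigma> i)) [1..<k]) *
       (Const (- r) * minor (w k) (w (Suc k)) (\<sigma> k) (\<sigma> (Suc k))) *
       prod_list (map (\<lambda>i. Var (w i, \<sigma> i)) [k + 2..<N + 1])))"
    unfolding row_det_pair[OF k] map1 map2
    unfolding comp_apply transpose_apply_first transpose_apply_second
  proof (intro cong_sum)
    fix \<sigma> assume "\<sigma> \<in> {\<sigma> \<in> {\<sigma>. \<sigma> permutes {1..N}}. \<sigma> k < \<sigma> (Suc k)}"
    then have \<sigma>: "\<sigma> permutes {1..N}" "\<sigma> k < \<sigma> (Suc k)" by simp_all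
    have range: "\<sigma> k \<in> {1..N}" "\<sigma> (Suc k) \<in> {1..N}" "w k \<in> {1..N}" "w (Suc k) \<in> {1..N}"
      using k by (intro perm_in_range[OF \<sigma>(1)] w; simp)+
    have "prod_list (map (\<lambda>i. Var (w i, \<sigma> i)) [1..<k]) \<in> C"
      "prod_list (map (\<lambda>i. Var (w i, \<sigma> i)) [k + 2..<N + 1]) \<in> C"
      using k by (intro prod_list_Var_in_C w \<sigma>(1); auto)+
    with minor_swap_rows[OF range(3,4,1,2) less \<sigma>(2)] show "Const (- r) ^ inversions N \<sigma> *
      (prod_list (map (\<lambda>i. Var (w i, \<sigma> i)) [1..<k]) *
       minor (w (Suc k)) (w k) (\<sigma> k) (\<sigma> (Suc k)) *
       prod_list (map (\<lambda>i. Var (w i, \<sigma> i)) [k + 2..<N + 1])) \<approx> Const (- r) ^ inversions N \<sigma> *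
      (prod_list (map (\<lambda>i. Var (w i, \<sigma> i)) [1..<k]) *
       (Const (- r) * minor (w k) (w (Suc k)) (\<sigma> k) (\<sigma> (Suc k))) *
       prod_list (map (\<lambda>i. Var (w i, \<sigma> i)) [k + 2..<N + 1]))"
      by (intro cong_mult_left cong_mult_right C_Const_power)
  qed
  also have "\<dots> = Const (- r) * row_det w"
    unfolding row_det_pair[OF k, of w]
    by (simp only: sum_distrib_left Const_left_commute mult.assoc)
  finally show ?thesis .
qed

text \<open>Each descent of \<open>m\<close> is removed by an adjacent transposition, which lowers the number of
  inversions; without descents and repeated neighbours \<open>m\<close> is the identity.\<close>

lemma cong_straighten:
  fixes E :: "(nat \<Rightarrow> nat) \<Rightarrow> (nat \<times> nat) ncpoly"
  assumes equal: "\<And>m k. \<lbrakk>\<And>i. i \<in> {1..n} \<Longrightarrow> m i \<in> {1..n}; 1 \<le> k; k < n; m k = m (Suc k)\<rbrakk> \<Longrightarrow> E m \<approx> 0"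
    and swap: "\<And>m k. \<lbrakk>\<And>i. i \<in> {1..n} \<Longrightarrow> m i \<in> {1..n}; 1 \<le> k; k < n; m k < m (Suc k)\<rbrakk>
        \<Longrightarrow> E (m \<circ> adj k) \<approx> Const c * E m"
    and E_cong: "\<And>m m'. (\<And>i. i \<in> {1..n} \<Longrightarrow> m i = m' i) \<Longrightarrow> E m = E m'"
    and m: "\<And>i. i \<in> {1..n} \<Longrightarrow> m i \<in> {1..n}"
  shows "E m \<approx> (if inj_on m {1..n} then Const (c ^ inversions n m) * E id else 0)"
  using m
proof (induction "inversions n m" arbitrary: m rule: less_induct)
  case less
  consider (eq) k where "1 \<le> k" "k < n" "m k = m (Suc k)"
    | (desc) k where "1 \<le> k" "k < n" "m (Suc k) < m k"
    | (asc) "\<And>k. 1 \<le> k \<Longrightarrow> k < n \<Longrightarrow> m k < m (Suc k)"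
    by (meson linorder_neqE_nat)
  then show ?case
  proof cases
    case eq
    then have "\<not> inj_on m {1..n}"
      by (auto dest: inj_onD)
    with equal[OF less.prems eq] show ?thesis by simp
  next
    case desc
    define m' where "m' = m \<circ> adj k"
    have m: "m = m' \<circ> adj k"
      by (simp add: m'_def comp_assoc)
    have asc': "m' k < m' (Suc k)"
      using desc by (simp add: m'_def)
    have adj: "adj k permutes {1..n}"
      using desc by (intro permutes_swap_id) auto
    have range: "m' i \<in> {1..n}" if "i \<in> {1..n}" for i
      using less.prems[of "adj k i"] permutes_in_image[OF adj, of i] that by (simp add: m'_def)
    have inv: "inversions n m = Suc (inversions n m')"
      unfolding m by (rule inversions_comp_adj) (use desc asc' in auto)
    have inj: "inj_on m {1..n} \<longleftrightarrow> inj_on m' {1..n}"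
      unfolding m'_def using comp_inj_on_iff[OF permutes_inj_on[OF adj], of m "{1..n}"]
      by (simp only: permutes_image[OF adj])
    have "E m \<approx> Const c * E m'"
      unfolding m using range desc asc' by (intro swap)
    also have "\<dots> \<approx> Const c * (if inj_on m' {1..n} then Const (c ^ inversions n m') * E id else 0)"
      by (intro cong_mult_left C_Const less.hyps range) (simp_all add: inv)
    also have "\<dots> = (if inj_on m {1..n} then Const (c ^ inversions n m) * E id else 0)"
      by (simp only: inj inv power_Suc mult.assoc[symmetric] Const_mult_Const if_distrib[of "(*) (Const c)"] mult_zero_right)
    finally show ?thesis .
  next
    case asc
    have grow: "m i + d \<le> m (i + d)" if "1 \<le> i" "i + d \<le> n" for i d
      using that(2)
    proof (induction d)
      case (Suc d)
      then show ?case using asc[of "i + d"] \<open>1 \<le> i\<close> by simp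
    qed simp
    \<comment> \<open>Growth from \<open>1\<close> to \<open>i\<close> gives
      \<open>i \<le> m i\<close>; growth from \<open>i\<close> to \<open>n\<close> gives
      \<open>m i \<le> i\<close>, since \<open>m n \<le> n\<close>.\<close>
    have id: "m i = i" if "i \<in> {1..n}" for i
      using grow[of 1 "i - 1"] grow[of i "n - i"] less.prems[of 1] less.prems[of n] that by auto
    then have "inj_on m {1..n}"
      by (auto intro: inj_onI)
    moreover have "inversions n m = 0"
      by (auto simp: inversions_def id card_eq_0_iff)
    moreover have "E m = E id"
      by (rule E_cong) (simp add: id)
    ultimately show ?thesis by simp
  qed
qed

section \<open>Words of row pairs and their straightening\<close>

text \<open>The row word of the product of \<open>y_{m(1)}\<close>, ..., \<open>y_{m(n)}\<close>,
  each \<open>y\<close> being spelled out as its two row forms.\<close>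

definition block_rows :: "(nat \<Rightarrow> nat) \<Rightarrow> nat \<Rightarrow> nat" where
  "block_rows m k = (if odd k then 2 * m (Suc k div 2) - 1 else 2 * m (k div 2))"

lemma block_rows_even: "block_rows m (2 * i) = 2 * m i"
  by (simp add: block_rows_def)

lemma block_rows_odd: "1 \<le> i \<Longrightarrow> block_rows m (2 * i - 1) = 2 * m i - 1"
  by (auto simp: block_rows_def elim!: oddE)

lemma block_rows_Suc: "block_rows m (Suc (2 * i)) = 2 * m (Suc i) - 1"
  using block_rows_odd[of "Suc i"] by simp

lemma even_odd_pos_cases:
  assumes "1 \<le> (k::nat)"
  obtains i where "1 \<le> i" "k = 2 * i" | i where "1 \<le> i" "k = 2 * i - 1"
proof (cases "even k")
  case True
  then show ?thesis using assms that(1)[of "k div 2"] by auto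
next
  case False
  then show ?thesis using that(2)[of "Suc k div 2"] by auto
qed

lemma block_rows_range:
  assumes "N = 2 * n" "\<And>i. i \<in> {1..n} \<Longrightarrow> m i \<in> {1..n}" "k \<in> {1..N}"
  shows "block_rows m k \<in> {1..N}"
proof -
  have "1 \<le> k" using assms by simp
  then show ?thesis
  proof (cases rule: even_odd_pos_cases)
    case (1 i)
    then show ?thesis using assms(2)[of i] assms(1,3) by (auto simp: block_rows_even)
  next
    case (2 i)
    with assms(1,3) have "i \<in> {1..n}" by auto
    from assms(2)[OF this] 2(1) assms(1) show ?thesis
      unfolding 2(2) block_rows_odd[OF 2(1)] by auto
  qed
qed

text \<open>Four adjacent transpositions exchange neighbouring blocks: \<open>abcd\<close>,
  \<open>acbd\<close>, \<open>cabd\<close>, \<open>cadb\<close>, \<open>cdab\<close>. Hence the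
  fourth power of \<open>r\<close> in the commutation of blocks.\<close>

lemma adj_block:
  assumes "1 \<le> k" "1 \<le> i"
  shows "adj (2 * k) (adj (2 * k - 1) (adj (2 * k + 1) (adj (2 * k) (2 * i)))) = 2 * adj k i"
    and "adj (2 * k) (adj (2 * k - 1) (adj (2 * k + 1) (adj (2 * k) (2 * i - 1)))) = 2 * adj k i - 1"
proof -
  \<comment> \<open>Successor form removes the truncated subtractions before the cases are
    computed.\<close>
  obtain k' where k': "k = Suc k'" using assms(1) by (cases k) auto
  obtain i' where i': "i = Suc i'" using assms(2) by (cases i) auto
  consider "i = k" | "i = Suc k" | "i < k" | "Suc k < i" by linarith
  then have "adj (2 * k) (adj (2 * k - 1) (adj (2 * k + 1) (adj (2 * k) (2 * i)))) = 2 * adj k i \<and>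
    adj (2 * k) (adj (2 * k - 1) (adj (2 * k + 1) (adj (2 * k) (2 * i - 1)))) = 2 * adj k i - 1"
    by cases (simp_all add: adj_apply k' i')
  then show "adj (2 * k) (adj (2 * k - 1) (adj (2 * k + 1) (adj (2 * k) (2 * i)))) = 2 * adj k i"
    "adj (2 * k) (adj (2 * k - 1) (adj (2 * k + 1) (adj (2 * k) (2 * i - 1)))) = 2 * adj k i - 1"
    by blast+
qed

lemma block_rows_swap:
  assumes "1 \<le> k" "1 \<le> j"
  shows "block_rows (m \<circ> adj k) j =
    (block_rows m \<circ> adj (2 * k) \<circ> adj (2 * k - 1) \<circ> adj (2 * k + 1) \<circ> adj (2 * k)) j"
  using assms(2)
proof (cases rule: even_odd_pos_cases)
  case (1 i)
  then show ?thesis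
    by (simp only: comp_apply adj_block[OF assms(1)] block_rows_even)
next
  case (2 i)
  moreover have "1 \<le> adj k i"
    using assms(1) 2(1) by (simp add: transpose_def)
  ultimately show ?thesis
    by (simp only: comp_apply adj_block[OF assms(1)] block_rows_odd)
qed

text \<open>Two equal blocks read \<open>abab\<close>. Exchanging the middle letters gives
  \<open>aabb\<close>, which has equal neighbouring rows; this is the relation that
  \<open>y_m\<close> squares to zero.\<close>

lemma block_row_det_equal:
  assumes N: "N = 2 * n" and m: "\<And>i. i \<in> {1..n} \<Longrightarrow> m i \<in> {1..n}"
    and k: "1 \<le> k" "k < n" and eq: "m k = m (Suc k)"
  shows "row_det (block_rows m) \<approx> 0"
proof -
  define w where "w = block_rows m \<circ> adj (2 * k)"
  have range: "block_rows m j \<in> {1..N}" if "j \<in> {1..N}" for j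
    using N m that by (rule block_rows_range)
  have adj: "adj (2 * k) permutes {1..N}"
    using k N by (intro permutes_swap_id) auto
  have w: "w j \<in> {1..N}" if "j \<in> {1..N}" for j
    unfolding w_def comp_apply using range that by (simp only: permutes_in_image[OF adj])
  have m_pos: "1 \<le> m k"
    using m[of k] k by simp
  have rows: "block_rows m (2 * k) = 2 * m k" "block_rows m (Suc (2 * k)) = 2 * m k - 1"
    "block_rows m (2 * k - 1) = 2 * m k - 1"
    using k eq by (simp_all only: block_rows_even block_rows_odd block_rows_Suc)
  have w_eq: "w (2 * k - 1) = w (Suc (2 * k - 1))"
    using k rows by (simp add: w_def adj_apply)
  have less: "w (2 * k) < w (Suc (2 * k))"
    using m_pos rows by (simp add: w_def)
  \<comment> \<open>The exchange rule starts from an ascent, so the original word is read as the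
    swapped version of the ascending \<open>w\<close>.\<close>
  have "row_det (block_rows m) = row_det (w \<circ> adj (2 * k))"
    by (simp add: w_def comp_assoc)
  also have "\<dots> \<approx> Const (- r) * row_det w"
    using k N by (intro row_det_swap_rows w less) auto
  also have "\<dots> \<approx> Const (- r) * 0"
    using k N by (intro cong_mult_left row_det_equal_rows[OF _ _ w w_eq] C_Const) auto
  finally show ?thesis by simp
qed

text \<open>As \<open>m k < m (Suc k)\<close>, both rows of the first block are smaller than both
  rows of the second. Each of the four transpositions thus starts at an ascent and contributes
  \<open>- r\<close>, and the signs cancel.\<close>

lemma block_row_det_swap:
  assumes N: "N = 2 * n" and m: "\<And>i. i \<in> {1..n} \<Longrightarrow> m i \<in> {1..n}"
    and k: "1 \<le> k" "k < n" and less: "m k < m (Suc k)"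
  shows "row_det (block_rows (m \<circ> adj k)) \<approx> Const (r ^ 4) * row_det (block_rows m)"
proof -
  define w where "w = block_rows m"
  define w1 where "w1 = w \<circ> adj (2 * k)"
  define w2 where "w2 = w1 \<circ> adj (2 * k - 1)"
  define w3 where "w3 = w2 \<circ> adj (2 * k + 1)"
  have adj_range: "v (adj l j) \<in> {1..N}"
    if "\<And>j. j \<in> {1..N} \<Longrightarrow> v j \<in> {1..N}" "1 \<le> l" "l < N" "j \<in> {1..N}" for v l j
  proof -
    have "adj l permutes {1..N}"
      using that(2,3) by (intro permutes_swap_id) auto
    with that(1,4) show ?thesis by (simp only: permutes_in_image)
  qed
  have bounds: "1 \<le> 2 * k" "2 * k < N" "1 \<le> 2 * k - 1" "2 * k - 1 < N" "1 \<le> 2 * k + 1" "2 * k + 1 < N"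
    using k N by auto
  have rg: "w j \<in> {1..N}" if "j \<in> {1..N}" for j
    unfolding w_def using N m that by (rule block_rows_range)
  have rg1: "w1 j \<in> {1..N}" if "j \<in> {1..N}" for j
    unfolding w1_def comp_apply using adj_range[OF rg bounds(1,2) that] .
  have rg2: "w2 j \<in> {1..N}" if "j \<in> {1..N}" for j
    unfolding w2_def comp_apply using adj_range[OF rg1 bounds(3,4) that] .
  have rg3: "w3 j \<in> {1..N}" if "j \<in> {1..N}" for j
    unfolding w3_def comp_apply using adj_range[OF rg2 bounds(5,6) that] .
  have m_pos: "1 \<le> m k"
    using m[of k] k by simp
  obtain k' where k': "k = Suc k'"
    using k by (cases k) auto
  have w_vals: "w (Suc (2 * k')) = 2 * m k - 1" "w (Suc (Suc (2 * k'))) = 2 * m k"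
    "w (Suc (Suc (Suc (2 * k')))) = 2 * m (Suc k) - 1"
    "w (Suc (Suc (Suc (Suc (2 * k'))))) = 2 * m (Suc k)"
    using block_rows_odd[of k m] block_rows_even[of m k] block_rows_Suc[of m k]
      block_rows_even[of m "Suc k"] by (simp_all add: w_def k')
  \<comment> \<open>These ascents license the four exchanges in the order in which they are
    composed.\<close>
  have asc: "w (2 * k) < w (Suc (2 * k))" "w1 (2 * k - 1) < w1 (Suc (2 * k - 1))"
    "w2 (2 * k + 1) < w2 (Suc (2 * k + 1))" "w3 (2 * k) < w3 (Suc (2 * k))"
    using less m_pos w_vals by (simp_all add: w1_def w2_def w3_def k' adj_apply)
  have "row_det (block_rows (m \<circ> adj k)) = row_det (w3 \<circ> adj (2 * k))"
    unfolding w3_def w2_def w1_def w_def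
    using k by (intro row_det_cong block_rows_swap) auto
  also have "\<dots> \<approx> Const (- r) * row_det w3"
    using bounds by (intro row_det_swap_rows rg3 asc)
  also have "\<dots> \<approx> Const (- r) * (Const (- r) * row_det w2)"
    unfolding w3_def using bounds by (intro cong_mult_left C_Const row_det_swap_rows rg2 asc)
  also have "\<dots> \<approx> Const (- r) * (Const (- r) * (Const (- r) * row_det w1))"
    unfolding w2_def using bounds by (intro cong_mult_left C_Const row_det_swap_rows rg1 asc)
  also have "\<dots> \<approx> Const (- r) * (Const (- r) * (Const (- r) * (Const (- r) * row_det w)))"
    unfolding w1_def using bounds by (intro cong_mult_left C_Const row_det_swap_rows rg asc)
  also have "\<dots> = Const (r ^ 4) * row_det w"
    by (simp only: mult.assoc[symmetric] Const_mult_Const) (simp add: power4_eq_xxxx)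
  finally show ?thesis
    by (simp only: w_def)
qed

text \<open>Straightening with \<open>c = r ^ 4\<close>, based on the two preceding relations
  between blocks.\<close>

lemma block_row_det:
  assumes N: "N = 2 * n" and m: "\<And>i. i \<in> {1..n} \<Longrightarrow> m i \<in> {1..n}"
  shows "row_det (block_rows m) \<approx>
    (if inj_on m {1..n} then Const ((r ^ 4) ^ inversions n m) * row_det id else 0)"
proof -
  have id: "row_det (block_rows id) = row_det id"
    by (intro row_det_cong) (auto simp: block_rows_def)
  \<comment> \<open>Straightening requires that the determinant depend only on the values of
    \<open>m\<close> on \<open>{1..n}\<close>.\<close>
  have "block_rows m k = block_rows m' k"
    if "\<And>i. i \<in> {1..n} \<Longrightarrow> m i = m' i" "k \<in> {1..N}" for m m' k
  proof -
    have "k div 2 \<in> {1..n}" if "even k" using that \<open>k \<in> {1..N}\<close> N by auto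
    moreover have "Suc k div 2 \<in> {1..n}" if "odd k" using that \<open>k \<in> {1..N}\<close> N by (auto elim!: oddE)
    ultimately show ?thesis using that(1) by (simp add: block_rows_def)
  qed
  then have "row_det (block_rows m) = row_det (block_rows m')"
    if "\<And>i. i \<in> {1..n} \<Longrightarrow> m i = m' i" for m m'
    using that by (intro row_det_cong) blast
  from cong_straighten[OF block_row_det_equal[OF N] block_row_det_swap[OF N] this m]
  show ?thesis by (simp only: id)
qed

section \<open>The unnormalised Pfaffian sum\<close>

text \<open>Both sides are the top coefficient of the product of the row forms with indices
  \<open>w 1\<close>, ..., \<open>w N\<close>, on the left after multiplying neighbouring forms in
  pairs. The equality holds already for free polynomials.\<close>

lemma sum_pfaffian_perms_minors:
  assumes N: "N = 2 * n"
  shows "(\<Sum>\<sigma>\<in>pfaffian_perms n. Const (- r) ^ inversions N \<sigma> * prod_list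
      (map (\<lambda>i. minor (w (2 * i - 1)) (w (2 * i)) (\<sigma> (2 * i - 1)) (\<sigma> (2 * i))) [1..<n + 1])) =
    row_det w"
proof -
  \<comment> \<open>\<open>P t\<close> interpolates between all permutations and \<open>pfaffian_perms n\<close>: pairing \<open>\<sigma>\<close> with
    \<open>\<sigma> \<circ> adj (2 * t + 1)\<close> turns the product of the entries in the rows \<open>w (2 * t + 1)\<close> and
    \<open>w (2 * t + 2)\<close> into a minor.\<close>
  define P where
    "P t = {\<sigma>. \<sigma> permutes {1..N} \<and> (\<forall>i\<in>{1..t}. \<sigma> (2 * i - 1) < \<sigma> (2 * i))}" for t
  define f where
    "f \<sigma> i = minor (w (2 * i - 1)) (w (2 * i)) (\<sigma> (2 * i - 1)) (\<sigma> (2 * i))" for \<sigma> i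
  define g :: "_ \<Rightarrow> _ \<Rightarrow> (nat \<times> nat) ncpoly" where
    "g \<sigma> i = Var (w (2 * i - 1), \<sigma> (2 * i - 1)) * Var (w (2 * i), \<sigma> (2 * i))" for \<sigma> i
  define F where
    "F t \<sigma> = prod_list (map (f \<sigma>) [1..<t + 1]) * prod_list (map (g \<sigma>) [t + 1..<n + 1])" for t \<sigma>
  have "(\<Sum>\<sigma>\<in>P t. Const (- r) ^ inversions N \<sigma> * F t \<sigma>) = row_det w" if "t \<le> n" for t
    using that
  proof (induction t)
    case 0
    have "F 0 \<sigma> = prod_list (map (\<lambda>k. Var (w k, \<sigma> k)) [1..<N + 1])" for \<sigma>
      unfolding F_def g_def N prod_list_upt_pairs[symmetric] by simp
    then show ?case
      by (simp add: row_det_def P_def)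
  next
    case (Suc t)
    define k where "k = Suc (2 * t)"
    have k: "1 \<le> k" "k < N" using Suc.prems N by (auto simp: k_def)
    have ki: "2 * Suc t - 1 = k" "2 * Suc t = Suc k" by (simp_all add: k_def)
    \<comment> \<open>With \<open>k = 2 * t + 1\<close> the transposition acts inside pair
      \<open>Suc t\<close> and fixes all other pairs.\<close>
    have adj: "(\<sigma> \<circ> adj k) (2 * i - 1) = \<sigma> (2 * i - 1)" "(\<sigma> \<circ> adj k) (2 * i) = \<sigma> (2 * i)"
      if "i \<le> t \<or> Suc t < i" for \<sigma> i
    proof -
      have "2 * i < k \<or> Suc k < 2 * i - 1"
        using that by (auto simp: k_def)
      then show "(\<sigma> \<circ> adj k) (2 * i - 1) = \<sigma> (2 * i - 1)" "(\<sigma> \<circ> adj k) (2 * i) = \<sigma> (2 * i)"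
        by (auto simp: adj_apply)
    qed
    have step: "F t \<sigma> + Const (- r) * F t (\<sigma> \<circ> adj k) = F (Suc t) \<sigma>" for \<sigma>
    proof -
      have "f (\<sigma> \<circ> adj k) i = f \<sigma> i" "g (\<sigma> \<circ> adj k) i = g \<sigma> i"
        if "i \<le> t \<or> Suc t < i" for i
        by (simp_all only: f_def g_def adj[OF that])
      then have "map (f (\<sigma> \<circ> adj k)) [1..<t + 1] = map (f \<sigma>) [1..<t + 1]"
        "map (g (\<sigma> \<circ> adj k)) [Suc t + 1..<n + 1] = map (g \<sigma>) [Suc t + 1..<n + 1]"
        by auto
      moreover have "[t + 1..<n + 1] = Suc t # [Suc t + 1..<n + 1]"
        using Suc.prems by (simp add: upt_conv_Cons)
      moreover have "g \<sigma> (Suc t) = Var (w k, \<sigma> k) * Var (w (Suc k), \<sigma> (Suc k))"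
        "g (\<sigma> \<circ> adj k) (Suc t) = Var (w k, \<sigma> (Suc k)) * Var (w (Suc k), \<sigma> k)"
        unfolding g_def ki by simp_all
      moreover have "f \<sigma> (Suc t) = Var (w k, \<sigma> k) * Var (w (Suc k), \<sigma> (Suc k))
          - Const r * (Var (w k, \<sigma> (Suc k)) * Var (w (Suc k), \<sigma> k))"
        by (simp only: f_def ki minor_def diff_Suc_1)
      moreover have "[1..<Suc t + 1] = [1..<t + 1] @ [Suc t]"
        by simp
      ultimately show ?thesis
        unfolding F_def
        by (simp only: map_append list.map prod_list.append prod_list.Cons prod_list.Nil mult_1_right
            single_uminus mult_minus_left right_diff_distrib left_diff_distrib
            Const_left_commute mult.assoc) simp
    qed
    have "\<sigma> \<circ> adj k \<in> P t" if "\<sigma> \<in> P t" for \<sigma>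
    proof -
      have "\<sigma> \<circ> adj k permutes {1..N}"
        using that k by (intro permutes_compose permutes_swap_id) (auto simp: P_def)
      moreover have "(\<sigma> \<circ> adj k) (2 * i - 1) < (\<sigma> \<circ> adj k) (2 * i)" if "i \<in> {1..t}" for i
      proof -
        have "i \<le> t \<or> Suc t < i" using that by simp
        moreover have "\<sigma> (2 * i - 1) < \<sigma> (2 * i)"
          using that \<open>\<sigma> \<in> P t\<close> unfolding P_def by blast
        ultimately show ?thesis by (simp only: adj)
      qed
      ultimately show ?thesis
        unfolding P_def by blast
    qed
    moreover have "\<sigma> k \<noteq> \<sigma> (Suc k)" if "\<sigma> \<in> P t" for \<sigma>
    proof -
      have "inj \<sigma>" using that by (auto simp: P_def permutes_inj)
      then show ?thesis by (simp add: inj_eq)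
    qed
    moreover have "finite (P t)"
      by (rule finite_subset[of _ "{\<sigma>. \<sigma> permutes {1..N}}"]) (auto simp: P_def finite_permutations)
    ultimately have "(\<Sum>\<sigma>\<in>P t. Const (- r) ^ inversions N \<sigma> * F t \<sigma>) =
        (\<Sum>\<sigma>\<in>{\<sigma> \<in> P t. \<sigma> k < \<sigma> (Suc k)}. Const (- r) ^ inversions N \<sigma> *
          (F t \<sigma> + Const (- r) * F t (\<sigma> \<circ> adj k)))"
      by (intro sum_pair_adj[OF k])
    \<comment> \<open>The ascent at \<open>k\<close> is the condition that \<open>P (Suc t)\<close>
      adds to \<open>P t\<close>.\<close>
    also have "{\<sigma> \<in> P t. \<sigma> k < \<sigma> (Suc k)} = P (Suc t)"
    proof -
      have "{1..Suc t} = insert (Suc t) {1..t}" by auto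
      then show ?thesis
        unfolding P_def by (simp only: ball_simps ki diff_Suc_1) blast
    qed
    also have "(\<Sum>\<sigma>\<in>P (Suc t). Const (- r) ^ inversions N \<sigma> * (F t \<sigma> + Const (- r) * F t (\<sigma> \<circ> adj k))) =
        (\<Sum>\<sigma>\<in>P (Suc t). Const (- r) ^ inversions N \<sigma> * F (Suc t) \<sigma>)"
      by (simp only: step)
    finally show ?case
      using Suc by simp
  qed
  \<comment> \<open>At \<open>t = n\<close> no unpaired entries remain.\<close>
  from this[of n] show ?thesis
    by (simp add: F_def f_def[abs_def] P_def pfaffian_perms_def N)
qed

text \<open>Injective self-maps of \<open>{1..n}\<close> are bijective. They correspond to
  permutations, the two encodings differing only outside \<open>{1..n}\<close>; the expansion of the
  product supplies the extensional one.\<close>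

lemma sum_inj_power_inversions:
  "(\<Sum>g\<in>{g \<in> {1..n} \<rightarrow>\<^sub>E {1..n}. inj_on g {1..n}}. q ^ inversions n g) = qfact q n"
proof -
  have ext: "\<sigma> permutes {1..n}"
    if g: "g \<in> {1..n} \<rightarrow>\<^sub>E {1..n}" "inj_on g {1..n}"
      and \<sigma>: "\<sigma> = (\<lambda>i. if i \<in> {1..n} then g i else i)" for g \<sigma>
  proof (rule bij_imp_permutes)
    have "g ` {1..n} = {1..n}"
      using g by (intro endo_inj_surj) auto
    then have "bij_betw g {1..n} {1..n}"
      using g(2) by (simp add: bij_betw_def)
    then show "bij_betw \<sigma> {1..n} {1..n}"
      by (subst bij_betw_cong[of _ _ g]) (auto simp: \<sigma>)
  qed (auto simp: \<sigma>)
  have inv: "inversions n g = inversions n g'" if "\<And>i. i \<in> {1..n} \<Longrightarrow> g i = g' i" for g g'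
    unfolding inversions_def using that by (intro arg_cong[of _ _ card]) auto
  have "(\<Sum>\<sigma> | \<sigma> permutes {1..n}. q ^ inversions n \<sigma>) =
      (\<Sum>g\<in>{g \<in> {1..n} \<rightarrow>\<^sub>E {1..n}. inj_on g {1..n}}. q ^ inversions n g)"
  proof (rule sum.reindex_bij_witness[of _ "\<lambda>g i. if i \<in> {1..n} then g i else i"
        "\<lambda>\<sigma>. restrict \<sigma> {1..n}"])
    fix \<sigma> assume "\<sigma> \<in> {\<sigma>. \<sigma> permutes {1..n}}"
    then have \<sigma>: "\<sigma> permutes {1..n}" by simp
    show "(\<lambda>i. if i \<in> {1..n} then restrict \<sigma> {1..n} i else i) = \<sigma>"
      using permutes_not_in[OF \<sigma>] by (auto simp: fun_eq_iff)
    have "\<sigma> i \<in> {1..n}" if "i \<in> {1..n}" for i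
      using \<sigma> that by (simp only: permutes_in_image)
    then show "restrict \<sigma> {1..n} \<in> {g \<in> {1..n} \<rightarrow>\<^sub>E {1..n}. inj_on g {1..n}}"
      using permutes_inj_on[OF \<sigma>] by (auto simp: PiE_iff)
    show "q ^ inversions n (restrict \<sigma> {1..n}) = q ^ inversions n \<sigma>"
      by (intro arg_cong[of _ _ "power q"] inv) simp
  next
    fix g assume g: "g \<in> {g \<in> {1..n} \<rightarrow>\<^sub>E {1..n}. inj_on g {1..n}}"
    then show "restrict (\<lambda>i. if i \<in> {1..n} then g i else i) {1..n} = g"
      by (auto simp: fun_eq_iff PiE_iff extensional_def)
    show "(\<lambda>i. if i \<in> {1..n} then g i else i) \<in> {\<sigma>. \<sigma> permutes {1..n}}"
      using g ext by blast
  qed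
  then show ?thesis
    by (simp only: sum_power_inversions)
qed

text \<open>A polynomial representative of the entry \<open>b_{ij}\<close>.\<close>

definition form_entry :: "nat \<Rightarrow> nat \<Rightarrow> nat \<Rightarrow> (nat \<times> nat) ncpoly" where
  "form_entry n i j = (\<Sum>m\<in>{1..n}. Var (2 * m - 1, i) * Var (2 * m, j)
     - Const (inverse s) * (Var (2 * m, i) * Var (2 * m - 1, j)))"

lemma form_entry_in_C:
  "N = 2 * n \<Longrightarrow> i \<in> {1..N} \<Longrightarrow> j \<in> {1..N} \<Longrightarrow> form_entry n i j \<in> C"
  unfolding form_entry_def by (intro C_sum C_diff C_mult C_Const C_Var) auto

text \<open>The parameter \<open>inverse s\<close> of the block matrix matches
  \<open>column_relation\<close> for the rows \<open>2 * m - 1\<close> and \<open>2 * m\<close>.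
  Each summand thereby becomes the coefficient of \<open>x_i x_j\<close> in
  \<open>y_m\<close>.\<close>

lemma form_entry_minors:
  assumes "N = 2 * n" "i \<in> {1..N}" "j \<in> {1..N}" "i < j"
  shows "form_entry n i j \<approx> (\<Sum>m\<in>{1..n}. minor (2 * m - 1) (2 * m) i j)"
  unfolding form_entry_def
proof (rule cong_sum)
  fix m assume "m \<in> {1..n}"
  then have "Const r * (Var (2 * m - 1, j) * Var (2 * m, i)) \<approx>
      Const (inverse s) * (Var (2 * m, i) * Var (2 * m - 1, j))"
    using assms by (intro column_relation) auto
  then show "Var (2 * m - 1, i) * Var (2 * m, j) - Const (inverse s) * (Var (2 * m, i) * Var (2 * m - 1, j))
      \<approx> minor (2 * m - 1) (2 * m) i j"
    unfolding cong_def minor_def by simp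
qed

text \<open>Expanding the sums of minors yields one block word per choice function \<open>g\<close>.
  Words with a repeated block vanish; the others are straightened, and their powers of
  \<open>r ^ 4\<close> add up to the factorial.\<close>

lemma pfaffian_sum_cong:
  assumes N: "N = 2 * n"
  shows "(\<Sum>\<sigma>\<in>pfaffian_perms n. Const (- r) ^ inversions N \<sigma> * prod_list
      (map (\<lambda>i. form_entry n (\<sigma> (2 * i - 1)) (\<sigma> (2 * i))) [1..<n + 1])) \<approx>
    Const (qfact (r ^ 4) n) * row_det id"
proof -
  let ?G = "{1..n} \<rightarrow>\<^sub>E {1..n}"
  have fin: "finite ?G"
    by (intro finite_PiE) auto
  have "(\<Sum>\<sigma>\<in>pfaffian_perms n. Const (- r) ^ inversions N \<sigma> * prod_list
      (map (\<lambda>i. form_entry n (\<sigma> (2 * i - 1)) (\<sigma> (2 * i))) [1..<n + 1])) \<approx>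
    (\<Sum>\<sigma>\<in>pfaffian_perms n. Const (- r) ^ inversions N \<sigma> * prod_list
      (map (\<lambda>i. \<Sum>m\<in>{1..n}. minor (2 * m - 1) (2 * m) (\<sigma> (2 * i - 1)) (\<sigma> (2 * i))) [1..<n + 1]))"
  proof (intro cong_sum cong_mult_left C_Const_power cong_prod_list conjI)
    fix \<sigma> i assume "\<sigma> \<in> pfaffian_perms n" and "i \<in> set [1..<n + 1]"
    then have \<sigma>: "\<sigma> permutes {1..N}" and i: "2 * i - 1 \<in> {1..N}" "2 * i \<in> {1..N}"
      and less: "\<sigma> (2 * i - 1) < \<sigma> (2 * i)"
      by (auto simp: pfaffian_perms_def N)
    note range = perm_in_range[OF \<sigma> i(1)] perm_in_range[OF \<sigma> i(2)]
    show "form_entry n (\<sigma> (2 * i - 1)) (\<sigma> (2 * i)) \<in> C"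
      using N range by (rule form_entry_in_C)
    show "form_entry n (\<sigma> (2 * i - 1)) (\<sigma> (2 * i)) \<approx>
        (\<Sum>m\<in>{1..n}. minor (2 * m - 1) (2 * m) (\<sigma> (2 * i - 1)) (\<sigma> (2 * i)))"
      using N range less by (rule form_entry_minors)
    show "(\<Sum>m\<in>{1..n}. minor (2 * m - 1) (2 * m) (\<sigma> (2 * i - 1)) (\<sigma> (2 * i))) \<in> C"
      by (intro C_sum minor_in_C range) (auto simp: N)
  qed
  also have "\<dots> = (\<Sum>\<sigma>\<in>pfaffian_perms n. \<Sum>g\<in>?G. Const (- r) ^ inversions N \<sigma> * prod_list
      (map (\<lambda>i. minor (2 * g i - 1) (2 * g i) (\<sigma> (2 * i - 1)) (\<sigma> (2 * i))) [1..<n + 1]))"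
  proof (rule sum.cong[OF refl])
    fix \<sigma>
    have "set [1..<n + 1] = {1..n}" by auto
    then show "Const (- r) ^ inversions N \<sigma> * prod_list
        (map (\<lambda>i. \<Sum>m\<in>{1..n}. minor (2 * m - 1) (2 * m) (\<sigma> (2 * i - 1)) (\<sigma> (2 * i))) [1..<n + 1]) =
      (\<Sum>g\<in>?G. Const (- r) ^ inversions N \<sigma> * prod_list
        (map (\<lambda>i. minor (2 * g i - 1) (2 * g i) (\<sigma> (2 * i - 1)) (\<sigma> (2 * i))) [1..<n + 1]))"
      using prod_list_sum[of "[1..<n + 1]" "{1..n}"
          "\<lambda>i m. minor (2 * m - 1) (2 * m) (\<sigma> (2 * i - 1)) (\<sigma> (2 * i))"]
      by (simp only: distinct_upt finite_atLeastAtMost sum_distrib_left simp_thms)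
  qed
  \<comment> \<open>After the interchange the inner sum, for fixed \<open>g\<close>, is the paired
    expansion of a single determinant.\<close>
  also have "\<dots> = (\<Sum>g\<in>?G. \<Sum>\<sigma>\<in>pfaffian_perms n. Const (- r) ^ inversions N \<sigma> * prod_list
      (map (\<lambda>i. minor (2 * g i - 1) (2 * g i) (\<sigma> (2 * i - 1)) (\<sigma> (2 * i))) [1..<n + 1]))"
    by (rule sum.swap)
  also have "\<dots> = (\<Sum>g\<in>?G. row_det (block_rows g))"
  proof (rule sum.cong[OF refl])
    fix g
    show "(\<Sum>\<sigma>\<in>pfaffian_perms n. Const (- r) ^ inversions N \<sigma> * prod_list
        (map (\<lambda>i. minor (2 * g i - 1) (2 * g i) (\<sigma> (2 * i - 1)) (\<sigma> (2 * i))) [1..<n + 1])) =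
      row_det (block_rows g)"
      unfolding sum_pfaffian_perms_minors[OF N, symmetric]
      by (intro sum.cong refl arg_cong2[of _ _ _ _ "(*)"] arg_cong[of _ _ prod_list] map_cong)
        (simp only: set_upt atLeastLessThan_iff block_rows_even block_rows_odd)
  qed
  also have "\<dots> \<approx> (\<Sum>g\<in>?G.
      if inj_on g {1..n} then Const ((r ^ 4) ^ inversions n g) * row_det id else 0)"
    by (intro cong_sum block_row_det[OF N]) (auto simp: PiE_iff)
  also have "\<dots> = (\<Sum>g\<in>{g \<in> ?G. inj_on g {1..n}}. Const ((r ^ 4) ^ inversions n g)) * row_det id"
    unfolding sum_distrib_right by (rule sum.inter_filter[OF fin, symmetric])
  also have "\<dots> = Const (qfact (r ^ 4) n) * row_det id"
    by (simp only: Const_sum[symmetric] sum_inj_power_inversions)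
  finally show ?thesis .
qed

end


section \<open>Passage to the quantum coordinate ring\<close>

text \<open>From \<open>(1 - u) * qint u k = 1 - u ^ k\<close>, a zero of \<open>qint\<close> at
  \<open>u = r ^ 4\<close> would force \<open>r ^ (4 * k) = 1\<close>.\<close>

lemma qfact_nonzero:
  assumes "\<not> root_of_unity r"
  shows "qfact (r ^ 4) n \<noteq> 0"
proof -
  have "qint (r ^ 4) k \<noteq> 0" if "k \<ge> 1" for k
  proof
    assume "qint (r ^ 4) k = 0"
    then have "r ^ (4 * k) = 1"
      using one_diff_power_eq[of "r ^ 4" k] by (simp add: qint_def power_mult)
    with that assms show False
      by (auto simp: root_of_unity_def dest!: spec[of _ "4 * k"])
  qed
  then show ?thesis
    by (simp add: qfact_def)
qed

lemma sum_upto_double: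
  fixes h :: "nat \<Rightarrow> 'b::comm_monoid_add"
  shows "(\<Sum>k\<in>{1..2 * n}. h k) = (\<Sum>m\<in>{1..n}. h (2 * m - 1) + h (2 * m))"
proof (induction n)
  case (Suc n)
  have "{1..2 * Suc n} = insert (Suc (2 * n)) (insert (2 * Suc n) {1..2 * n})"
    by auto
  then show ?case
    using Suc by (simp add: ac_simps)
qed simp

context qcoord_cong
begin

section \<open>Residue classes and the operations of the quotient\<close>

abbreviation M where
  "M \<equiv> qcoord r s N"

definition cls :: "(nat \<times> nat) ncpoly \<Rightarrow> (nat \<times> nat) ncpoly set" where
  "cls p = I +>\<^bsub>free_algebra (index_pairs N)\<^esub> p"

lemma M_eq: "M = quot_algebra (free_algebra (index_pairs N)) I"
  by (simp add: qcoord_def presented_algebra_def I_def)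

interpretation M: complex_assoc_algebra M
  by (rule qcoord_assoc_algebra)

lemma
  assumes "p \<in> C" "q \<in> C"
  shows cls_mult: "cls p \<otimes>\<^bsub>M\<^esub> cls q = cls (p * q)"
    and cls_add: "cls p \<oplus>\<^bsub>M\<^esub> cls q = cls (p + q)"
  using quot_algebra_class_ops[OF free_algebra_assoc_algebra ideal_I, of p q] assms
  by (simp_all add: M_eq cls_def C_def)

lemma cls_smult: "p \<in> C \<Longrightarrow> c \<odot>\<^bsub>M\<^esub> cls p = cls (Const c * p)"
  using quot_algebra_class_ops(3)[OF free_algebra_assoc_algebra ideal_I, of p p c]
  by (simp add: M_eq cls_def C_def)

lemma cls_carrier: "p \<in> C \<Longrightarrow> cls p \<in> carrier M"
  using quot_algebra_carrier[OF free_algebra_assoc_algebra ideal_I]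
  by (simp add: M_eq cls_def C_def)

lemma cls_zero: "cls 0 = \<zero>\<^bsub>M\<^esub>"
proof -
  have "cls 0 \<oplus>\<^bsub>M\<^esub> cls 0 = cls 0"
    by (simp add: cls_add)
  then show ?thesis
    using M.add.r_cancel_one'[of "cls 0" "cls 0"] cls_carrier[of 0] by simp
qed

lemma cls_one: "cls 1 = \<one>\<^bsub>M\<^esub>"
  by (simp add: M_eq cls_def quot_algebra_sel FactRing_def)

lemma cls_diff:
  assumes "p \<in> C" "q \<in> C"
  shows "cls p \<ominus>\<^bsub>M\<^esub> cls q = cls (p - q)"
proof -
  have "- q \<in> C"
    using C_diff[of 0 q] assms(2) by simp
  then have "\<ominus>\<^bsub>M\<^esub> cls q = cls (- q)"
    using assms by (intro M.minus_equality) (simp_all add: cls_add cls_zero cls_carrier)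
  with \<open>- q \<in> C\<close> show ?thesis
    using assms by (simp add: a_minus_def cls_add)
qed

text \<open>Here a congruence of polynomials becomes an equality in the quantum coordinate
  ring.\<close>

lemma cls_eqI:
  assumes "p \<approx> q" "p \<in> C" "q \<in> C"
  shows "cls p = cls q"
proof -
  have "p - q \<in> I" using assms(1) by (simp add: cong_def)
  then have "p \<in> I +>\<^bsub>free_algebra (index_pairs N)\<^esub> q"
    by (force simp: a_r_coset_def')
  then show ?thesis
    unfolding cls_def using assms(3) ideal_I
    by (metis C_def abelian_subgroup.a_repr_independence' abelian_subgroupI3
        free_algebra_ring ideal.axioms(1) ring.is_abelian_group)
qed

lemma cls_sum:
  assumes "\<And>x. x \<in> S \<Longrightarrow> f x \<in> C" "finite S"
  shows "(\<Oplus>\<^bsub>M\<^esub>x\<in>S. cls (f x)) = cls (sum f S)"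
  using assms(2,1)
proof (induction S rule: finite_induct)
  case (insert x S)
  then show ?case
    by (subst M.finsum_insert) (auto simp: cls_add C_sum intro: cls_carrier)
qed (simp add: cls_zero)

lemma cls_list_prod:
  assumes "\<And>x. x \<in> set xs \<Longrightarrow> f x \<in> C"
  shows "list_prod M (map (\<lambda>x. cls (f x)) xs) = cls (prod_list (map f xs))"
  using assms
proof (induction xs)
  case (Cons x xs)
  have "list_prod M (map (\<lambda>x. cls (f x)) (x # xs)) = cls (f x) \<otimes>\<^bsub>M\<^esub> list_prod M (map (\<lambda>x. cls (f x)) xs)"
    by (simp add: list_prod_def)
  also have "\<dots> = cls (prod_list (map f (x # xs)))"
  proof -
    have "f x \<in> C" "prod_list (map f xs) \<in> C"
      using Cons.prems by (auto intro!: C_prod_list)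
    with Cons show ?thesis by (simp add: cls_mult)
  qed
  finally show ?case .
qed (simp add: list_prod_def cls_one)

lemma qgen_eq_cls: "qgen r s N i j = cls (Var (i, j))"
  by (simp add: qgen_def presented_gen_def cls_def I_def)

section \<open>Matrix entries, determinant and Pfaffian as residue classes\<close>

text \<open>Column \<open>k\<close> of the block matrix has a single nonzero entry, in row
  \<open>k - 1\<close> for even \<open>k\<close> and in row \<open>k + 1\<close> for odd
  \<open>k\<close>, so the inner sum collapses.\<close>

lemma form_entry_eq_matrix_product:
  assumes "N = 2 * n"
  shows "(\<Sum>k\<in>{1..N}. (\<Sum>l\<in>{1..N}. Var (l, i) * Const (block_J (inverse s) l k)) * Var (k, j)) =
    form_entry n i j"
proof -
  \<comment> \<open>The condition \<open>1 \<le> l\<close> excludes \<open>k = 0\<close>,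
    \<open>l = 0\<close>, where truncated subtraction would give a wrong entry.\<close>
  have J: "block_J (inverse s) l k =
      (if l = (if even k then k - 1 else k + 1) then (if even k then 1 else - inverse s) else 0)"
    if "1 \<le> l" for l k
    using that by (auto simp: block_J_def)
  have inner: "(\<Sum>l\<in>{1..N}. Var (l, i) * Const (block_J (inverse s) l k)) =
      (if even k then Var (k - 1, i) else Const (- inverse s) * Var (k + 1, i))"
    if "k \<in> {1..N}" for k
  proof -
    let ?l = "if even k then k - 1 else k + 1"
    \<comment> \<open>For odd \<open>k\<close> the bound \<open>k + 1 \<le> N\<close> holds because
      \<open>N\<close> is even.\<close>
    have l: "?l \<in> {1..N}"
      using that assms by (cases "even k") (auto elim!: evenE, presburger)
    have "(\<Sum>l\<in>{1..N}. Var (l, i) * Const (block_J (inverse s) l k)) =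
        (\<Sum>l\<in>{1..N}. if l = ?l then Const (if even k then 1 else - inverse s) * Var (?l, i) else 0)"
      by (intro sum.cong) (auto simp: J Const_commute)
    also have "\<dots> = Const (if even k then 1 else - inverse s) * Var (?l, i)"
      using l by (simp only: sum.delta finite_atLeastAtMost if_True)
    finally show ?thesis by simp
  qed
  have "(\<Sum>k\<in>{1..N}. (\<Sum>l\<in>{1..N}. Var (l, i) * Const (block_J (inverse s) l k)) * Var (k, j)) =
      (\<Sum>k\<in>{1..N}. (if even k then Var (k - 1, i) else Const (- inverse s) * Var (k + 1, i)) * Var (k, j))"
    by (intro sum.cong refl) (simp only: inner)
  \<comment> \<open>The indices \<open>2 * m - 1\<close> and \<open>2 * m\<close> together give the
    summand for \<open>m\<close>; the odd one carries the factor \<open>- inverse s\<close>.\<close>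
  also have "\<dots> = form_entry n i j"
    unfolding assms sum_upto_double form_entry_def
  proof (rule sum.cong[OF refl])
    fix m assume "m \<in> {1..n}"
    then obtain m' where "m = Suc m'" by (cases m) auto
    then show "(if even (2 * m - 1) then Var (2 * m - 1 - 1, i)
        else Const (- inverse s) * Var (2 * m - 1 + 1, i)) * Var (2 * m - 1, j) +
      (if even (2 * m) then Var (2 * m - 1, i) else Const (- inverse s) * Var (2 * m + 1, i)) *
        Var (2 * m, j) =
      Var (2 * m - 1, i) * Var (2 * m, j) - Const (inverse s) * (Var (2 * m, i) * Var (2 * m - 1, j))"
      by (simp add: mult.assoc[symmetric] single_uminus)
  qed
  finally show ?thesis .
qed

lemma matrix_entry_eq_cls:
  assumes N: "N = 2 * n" and ij: "i \<in> {1..N}" "j \<in> {1..N}"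
  shows "mat_mult M N (mat_mult M N (mat_transpose (qgen r s N)) (scalar_mat M (block_J (inverse s))))
    (qgen r s N) i j = cls (form_entry n i j)"
proof -
  have scalar: "scalar_mat M (block_J (inverse s)) l k = cls (Const (block_J (inverse s) l k))" for l k
    by (simp add: scalar_mat_def cls_one[symmetric] cls_smult[OF C_one])
  have "mat_mult M N (mat_transpose (qgen r s N)) (scalar_mat M (block_J (inverse s))) i k =
      cls (\<Sum>l\<in>{1..N}. Var (l, i) * Const (block_J (inverse s) l k))" for k
  proof -
    have "mat_mult M N (mat_transpose (qgen r s N)) (scalar_mat M (block_J (inverse s))) i k =
        (\<Oplus>\<^bsub>M\<^esub>l\<in>{1..N}. cls (Var (l, i) * Const (block_J (inverse s) l k)))"
      unfolding mat_mult_def mat_transpose_def scalar qgen_eq_cls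
      using ij by (intro M.finsum_cong' refl funcsetI) (auto simp: cls_mult C_Var intro!: cls_carrier C_mult)
    then show ?thesis
      using ij by (subst cls_sum[symmetric]) (auto intro!: C_mult C_Var)
  qed
  then have "mat_mult M N (mat_mult M N (mat_transpose (qgen r s N)) (scalar_mat M (block_J (inverse s))))
      (qgen r s N) i j =
      (\<Oplus>\<^bsub>M\<^esub>k\<in>{1..N}. cls (\<Sum>l\<in>{1..N}. Var (l, i) * Const (block_J (inverse s) l k)) \<otimes>\<^bsub>M\<^esub> cls (Var (k, j)))"
    by (simp only: mat_mult_def[of M N "mat_mult M N _ _"] qgen_eq_cls)
  also have "\<dots> = (\<Oplus>\<^bsub>M\<^esub>k\<in>{1..N}.
      cls ((\<Sum>l\<in>{1..N}. Var (l, i) * Const (block_J (inverse s) l k)) * Var (k, j)))"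
    using ij by (intro M.finsum_cong' refl funcsetI cls_mult cls_carrier C_mult C_sum C_Var C_Const)
  also have "\<dots> = cls (\<Sum>k\<in>{1..N}. (\<Sum>l\<in>{1..N}. Var (l, i) * Const (block_J (inverse s) l k)) * Var (k, j))"
    using ij by (intro cls_sum C_mult C_sum C_Var C_Const) auto
  finally show ?thesis
    by (simp only: form_entry_eq_matrix_product[OF N])
qed

text \<open>This supplies the explicit entry formula, the first claim of the theorem.\<close>

lemma cls_form_entry:
  assumes N: "N = 2 * n" and ij: "i \<in> {1..N}" "j \<in> {1..N}"
  shows "cls (form_entry n i j) =
    (\<Oplus>\<^bsub>M\<^esub>m\<in>{1..n}. qgen r s N (2 * m - 1) i \<otimes>\<^bsub>M\<^esub> qgen r s N (2 * m) j
      \<ominus>\<^bsub>M\<^esub> inverse s \<odot>\<^bsub>M\<^esub> (qgen r s N (2 * m) i \<otimes>\<^bsub>M\<^esub> qgen r s N (2 * m - 1) j))"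
proof -
  have closed: "Var (2 * m - 1, i) * Var (2 * m, j) \<in> C" "Var (2 * m, i) * Var (2 * m - 1, j) \<in> C"
    and V: "Var (2 * m - 1, i) \<in> C" "Var (2 * m, i) \<in> C" "Var (2 * m - 1, j) \<in> C" "Var (2 * m, j) \<in> C"
    if "m \<in> {1..n}" for m
  proof -
    have "2 * m - 1 \<in> {1..N}" "2 * m \<in> {1..N}" using that N by auto
    then show "Var (2 * m - 1, i) \<in> C" "Var (2 * m, i) \<in> C" "Var (2 * m - 1, j) \<in> C" "Var (2 * m, j) \<in> C"
      using ij by (simp_all only: C_Var)
    then show "Var (2 * m - 1, i) * Var (2 * m, j) \<in> C" "Var (2 * m, i) * Var (2 * m - 1, j) \<in> C"
      by (simp_all only: C_mult)
  qed
  have "(\<Oplus>\<^bsub>M\<^esub>m\<in>{1..n}. qgen r s N (2 * m - 1) i \<otimes>\<^bsub>M\<^esub> qgen r s N (2 * m) j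
      \<ominus>\<^bsub>M\<^esub> inverse s \<odot>\<^bsub>M\<^esub> (qgen r s N (2 * m) i \<otimes>\<^bsub>M\<^esub> qgen r s N (2 * m - 1) j)) =
    (\<Oplus>\<^bsub>M\<^esub>m\<in>{1..n}. cls (Var (2 * m - 1, i) * Var (2 * m, j)
      - Const (inverse s) * (Var (2 * m, i) * Var (2 * m - 1, j))))"
  proof (intro M.finsum_cong' refl funcsetI)
    fix m assume m: "m \<in> {1..n}"
    show "qgen r s N (2 * m - 1) i \<otimes>\<^bsub>M\<^esub> qgen r s N (2 * m) j
        \<ominus>\<^bsub>M\<^esub> inverse s \<odot>\<^bsub>M\<^esub> (qgen r s N (2 * m) i \<otimes>\<^bsub>M\<^esub> qgen r s N (2 * m - 1) j) =
      cls (Var (2 * m - 1, i) * Var (2 * m, j) - Const (inverse s) * (Var (2 * m, i) * Var (2 * m - 1, j)))"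
      unfolding qgen_eq_cls cls_mult[OF V(1)[OF m] V(4)[OF m]] cls_mult[OF V(2)[OF m] V(3)[OF m]]
        cls_smult[OF closed(2)[OF m]]
      by (intro cls_diff closed[OF m] C_mult C_Const)
    show "cls (Var (2 * m - 1, i) * Var (2 * m, j) - Const (inverse s) * (Var (2 * m, i) * Var (2 * m - 1, j)))
        \<in> carrier M"
      by (intro cls_carrier C_diff C_mult[OF C_Const] closed[OF m])
  qed
  also have "\<dots> = cls (form_entry n i j)"
    unfolding form_entry_def by (intro cls_sum C_diff C_mult[OF C_Const] closed) auto
  finally show ?thesis ..
qed

lemma rdet_eq_cls: "rdet M r N (qgen r s N) = cls (row_det id)"
proof -
  have closed: "prod_list (map (\<lambda>k. Var (k, \<sigma> k)) [1..<N + 1]) \<in> C" if "\<sigma> permutes {1..N}" for \<sigma>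
    by (rule prod_list_Var_in_C[of "\<lambda>k. k", OF _ that]) auto
  have "rdet M r N (qgen r s N) = (\<Oplus>\<^bsub>M\<^esub>\<sigma>\<in>{\<sigma>. \<sigma> permutes {1..N}}.
      cls (Const (- r) ^ inversions N \<sigma> * prod_list (map (\<lambda>k. Var (k, \<sigma> k)) [1..<N + 1])))"
    unfolding rdet_def
  proof (intro M.finsum_cong' refl funcsetI)
    fix \<sigma> assume "\<sigma> \<in> {\<sigma>. \<sigma> permutes {1..N}}"
    then have \<sigma>: "\<sigma> permutes {1..N}" by simp
    have "list_prod M (map (\<lambda>i. qgen r s N i (\<sigma> i)) [1..<N + 1]) =
        cls (prod_list (map (\<lambda>k. Var (k, \<sigma> k)) [1..<N + 1]))"
      unfolding qgen_eq_cls by (rule cls_list_prod, intro C_Var perm_in_range[OF \<sigma>]; auto)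
    then show "(- r) ^ inversions N \<sigma> \<odot>\<^bsub>M\<^esub> list_prod M (map (\<lambda>i. qgen r s N i (\<sigma> i)) [1..<N + 1]) =
        cls (Const (- r) ^ inversions N \<sigma> * prod_list (map (\<lambda>k. Var (k, \<sigma> k)) [1..<N + 1]))"
      by (simp only: cls_smult[OF closed[OF \<sigma>]] Const_power)
    show "cls (Const (- r) ^ inversions N \<sigma> * prod_list (map (\<lambda>k. Var (k, \<sigma> k)) [1..<N + 1])) \<in> carrier M"
      by (intro cls_carrier C_mult C_Const_power closed \<sigma>)
  qed
  also have "\<dots> = cls (row_det id)"
    unfolding row_det_def id_apply
    by (intro cls_sum C_mult C_Const_power closed) (auto simp: finite_permutations)
  finally show ?thesis .
qed

lemma pfaffian_perms_range:
  assumes N: "N = 2 * n" and "\<sigma> \<in> pfaffian_perms n" "i \<in> set [1..<n + 1]"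
  shows "\<sigma> (2 * i - 1) \<in> {1..N}" "\<sigma> (2 * i) \<in> {1..N}"
proof -
  have \<sigma>: "\<sigma> permutes {1..N}" and i: "2 * i - 1 \<in> {1..N}" "2 * i \<in> {1..N}"
    using assms by (auto simp: pfaffian_perms_def)
  show "\<sigma> (2 * i - 1) \<in> {1..N}" "\<sigma> (2 * i) \<in> {1..N}"
    using perm_in_range[OF \<sigma> i(1)] perm_in_range[OF \<sigma> i(2)] .
qed

lemma pfaffian_entry_in_C:
  assumes "N = 2 * n" "\<sigma> \<in> pfaffian_perms n" "i \<in> set [1..<n + 1]"
  shows "form_entry n (\<sigma> (2 * i - 1)) (\<sigma> (2 * i)) \<in> C"
  using assms(1) pfaffian_perms_range[OF assms] by (rule form_entry_in_C)

text \<open>Pfaffian permutations select indices within \<open>{1..N}\<close> only, so it suffices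
  to know \<open>B\<close> there.\<close>

lemma qPf_eq_cls:
  assumes N: "N = 2 * n"
    and B: "\<And>i j. i \<in> {1..N} \<Longrightarrow> j \<in> {1..N} \<Longrightarrow> B i j = cls (form_entry n i j)"
  shows "qPf M r n B = cls (Const (1 / qfact (r ^ 4) n) *
    (\<Sum>\<sigma>\<in>pfaffian_perms n. Const (- r) ^ inversions N \<sigma> * prod_list
      (map (\<lambda>i. form_entry n (\<sigma> (2 * i - 1)) (\<sigma> (2 * i))) [1..<n + 1])))"
proof -
  let ?p = "\<lambda>\<sigma>. prod_list (map (\<lambda>i. form_entry n (\<sigma> (2 * i - 1)) (\<sigma> (2 * i))) [1..<n + 1])"
  note range = pfaffian_perms_range[OF N] and entry = pfaffian_entry_in_C[OF N]
  have closed: "?p \<sigma> \<in> C" if "\<sigma> \<in> pfaffian_perms n" for \<sigma>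
    using entry[OF that] by (intro C_prod_list) auto
  have fin: "finite (pfaffian_perms n)"
    by (rule finite_subset[of _ "{\<sigma>. \<sigma> permutes {1..2 * n}}"])
      (auto simp: pfaffian_perms_def finite_permutations)
  have sum_closed: "(\<Sum>\<sigma>\<in>pfaffian_perms n. Const (- r) ^ inversions N \<sigma> * ?p \<sigma>) \<in> C"
    by (intro C_sum C_mult C_Const_power closed)
  have "(\<Oplus>\<^bsub>M\<^esub>\<sigma>\<in>pfaffian_perms n. (- r) ^ inversions (2 * n) \<sigma> \<odot>\<^bsub>M\<^esub>
        list_prod M (map (\<lambda>i. B (\<sigma> (2 * i - 1)) (\<sigma> (2 * i))) [1..<n + 1])) =
      (\<Oplus>\<^bsub>M\<^esub>\<sigma>\<in>pfaffian_perms n. cls (Const (- r) ^ inversions N \<sigma> * ?p \<sigma>))"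
  proof (intro M.finsum_cong' refl funcsetI)
    fix \<sigma> assume \<sigma>: "\<sigma> \<in> pfaffian_perms n"
    have "map (\<lambda>i. B (\<sigma> (2 * i - 1)) (\<sigma> (2 * i))) [1..<n + 1] =
        map (\<lambda>i. cls (form_entry n (\<sigma> (2 * i - 1)) (\<sigma> (2 * i)))) [1..<n + 1]"
      by (intro map_cong refl B range[OF \<sigma>])
    then have "list_prod M (map (\<lambda>i. B (\<sigma> (2 * i - 1)) (\<sigma> (2 * i))) [1..<n + 1]) = cls (?p \<sigma>)"
      using cls_list_prod[OF entry[OF \<sigma>]] by (simp only:)
    then show "(- r) ^ inversions (2 * n) \<sigma> \<odot>\<^bsub>M\<^esub>
        list_prod M (map (\<lambda>i. B (\<sigma> (2 * i - 1)) (\<sigma> (2 * i))) [1..<n + 1]) =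
        cls (Const (- r) ^ inversions N \<sigma> * ?p \<sigma>)"
      by (simp only: cls_smult[OF closed[OF \<sigma>]] Const_power N[symmetric])
    show "cls (Const (- r) ^ inversions N \<sigma> * ?p \<sigma>) \<in> carrier M"
      by (intro cls_carrier C_mult C_Const_power closed \<sigma>)
  qed
  also have "\<dots> = cls (\<Sum>\<sigma>\<in>pfaffian_perms n. Const (- r) ^ inversions N \<sigma> * ?p \<sigma>)"
    by (intro cls_sum C_mult C_Const_power closed fin)
  finally show ?thesis
    unfolding qPf_def by (simp only: cls_smult[OF sum_closed])
qed

text \<open>The normalising scalar cancels the factorial from \<open>pfaffian_sum_cong\<close>; it
  is invertible because \<open>r\<close> is not a root of unity.\<close>

lemma qPf_eq_rdet:
  assumes N: "N = 2 * n" and r: "\<not> root_of_unity r"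
    and B: "\<And>i j. i \<in> {1..N} \<Longrightarrow> j \<in> {1..N} \<Longrightarrow> B i j = cls (form_entry n i j)"
  shows "qPf M r n B = rdet M r N (qgen r s N)"
proof -
  let ?P = "\<Sum>\<sigma>\<in>pfaffian_perms n. Const (- r) ^ inversions N \<sigma> * prod_list
      (map (\<lambda>i. form_entry n (\<sigma> (2 * i - 1)) (\<sigma> (2 * i))) [1..<n + 1])"
  have "Const (1 / qfact (r ^ 4) n) * ?P \<approx>
      Const (1 / qfact (r ^ 4) n) * (Const (qfact (r ^ 4) n) * row_det id)"
    by (intro cong_mult_left C_Const pfaffian_sum_cong N)
  also have "\<dots> = row_det id"
    using qfact_nonzero[OF r, of n] by (simp add: mult.assoc[symmetric] Const_mult_Const)
  finally have cong: "Const (1 / qfact (r ^ 4) n) * ?P \<approx> row_det id" .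
  have det: "row_det id \<in> C"
    by (rule row_det_in_C) simp
  have "Const (1 / qfact (r ^ 4) n) * ?P \<in> C"
    using pfaffian_entry_in_C[OF N] by (intro C_mult C_Const C_sum C_Const_power C_prod_list) auto
  from cls_eqI[OF cong this det] qPf_eq_cls[OF N, of B] B show ?thesis
    by (simp only: rdet_eq_cls)
qed

end

section \<open>The Pfaffian of the transformed form for generic parameters\<close>

theorem theorem3p1:
  fixes n :: nat and r s :: complex
  assumes "n \<ge> 1" and "generic r s"
  defines "M \<equiv> qcoord r s (2 * n)"
  defines "A \<equiv> qgen r s (2 * n)"
  defines "B \<equiv> mat_mult M (2 * n)
      (mat_mult M (2 * n) (mat_transpose A) (scalar_mat M (block_J (inverse s)))) A"
  shows "(\<forall>i\<in>{1..2 * n}. \<forall>j\<in>{1..2 * n}.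
            B i j = (\<Oplus>\<^bsub>M\<^esub>m\<in>{1..n}. A (2 * m - 1) i \<otimes>\<^bsub>M\<^esub> A (2 * m) j
                      \<ominus>\<^bsub>M\<^esub> inverse s \<odot>\<^bsub>M\<^esub> (A (2 * m) i \<otimes>\<^bsub>M\<^esub> A (2 * m - 1) j)))
         \<and> qPf M r n B = rdet M r (2 * n) A"
proof -
  \<comment> \<open>Genericity supplies \<open>s \<noteq> 0\<close> here and, below, the
    invertibility of the factorial.\<close>
  interpret qcoord_cong r s "2 * n"
    using assms(2) by unfold_locales (simp add: generic_def)
  have B: "B i j = cls (form_entry n i j)" if "i \<in> {1..2 * n}" "j \<in> {1..2 * n}" for i j
    unfolding B_def M_def A_def using refl that by (rule matrix_entry_eq_cls)
  have r: "\<not> root_of_unity r"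
    using assms(2) by (simp add: generic_def)
  have "qPf M r n B = rdet M r (2 * n) A"
    unfolding M_def A_def using refl r B by (rule qPf_eq_rdet)
  then show ?thesis
    using B cls_form_entry[OF refl] by (simp add: M_def A_def)
qed

end
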